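(* Let $Z\in\mathcal Z$ and $\mu\in\mathcal F_Z$. For every $\alpha>0$ and $f\in L^1(\mu)$, $$\mu(\{x\in G:\ \mathcal M_Zf(x)>\alpha\})\le\frac{C_2}{\alpha}\|f\|_1,$$ with $C_2=3\max\{\gamma+1+\log\lambda,\ \lambda e^3\}$, where $\mathcal M_Z$ is the Hardy–Littlewood maximal operator associated with admissible cylinders, $$\mathcal M_Zf(x)=\sup_{P\in\mathcal P^Z,\,P\ni x}\frac1{\mu(P)}\int_P|f|\,d\mu,$$ and $\mathcal P^Z$ is the family of all admissible cylinders.
   Context: **Group setting.** $N$ is a stratified Lie group of step $S\ge 1$: simply connected, with Lie algebra $\mathfrak n=\bigoplus_{j=1}^S\mathfrak n_j$, $[\mathfrak n_i,\mathfrak n_j]\subset\mathfrak n_{i+j}$ (with $\mathfrak n_l=0$ for $l>S$), $\mathfrak n_1$ generating $\mathfrak n$. $dn$ is the Haar measure on $N$ (push-forward of Lebesgue measure by $\exp_N$). $A=(\mathbb R_+,\cdot)$ acts on $N$ by the automorphic dilations $D_a(\exp_N(\sum_j Y_j))=\exp_N(\sum_j a^jY_j)$, $Y_j\in\mathfrak n_j$. $G=N\rtimes A$ has product $(n,a)(n',a')=(nD_a(n'),aa')$ and right Haar measure $d\rho(n,a)=a^{-1}\,dn\,da$. Fix bases $\{\breve X_{j,i}:1\le i\le q_j\}$ of $\mathfrak n_j$. $d_N$ is the (left-invariant) Carnot–Carathéodory distance on $N$ for which $\breve X_{1,1},\dots,\breve X_{1,q_1}$ is an orthonormal horizontal frame.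 In the Lie algebra $\mathfrak g=\mathfrak n\oplus\mathfrak a$ of $G$, $X_0$ is the generator of $A$ with $\exp(tX_0)=(1_N,e^t)$, and $X_{j,i}$ is the left-invariant vector field on $G$ whose value at the identity is $\breve X_{j,i}$. $\langle\cdot,\cdot\rangle$ is the scalar product on $\mathfrak g$ making $\{X_0\}\cup\{X_{j,i}\}_{j,i}$ orthonormal, and $\mathcal Z=\{Z\in\mathfrak g:\langle Z,X_0\rangle=1\}$. **Flow measures.** A Borel measure $\mu$ on $G$ is a $Z$-flow measure if $d\mu=\varphi\,d\rho$ with $\varphi:G\to[0,\infty)$ satisfying $\varphi(x)=\varphi(x\exp(tZ))$ for all $x\in G$, $t\in\mathbb R$. Put $\mu_N(F)=\int_F\varphi(n,1)\,dn$ for Borel $F\subset N$. $\mathcal F_Z$ is the set of $Z$-flow measures $\mu$ such that $(N,d_N,\mu_N)$ is doubling, i.e. balls have positive finite measure and for every $C>1$ there is $D(\mu_N,C)>1$ with $\mu_N(B(x,Cr))\le D(\mu_N,C)\mu_N(B(x,r))$ for all $x\in N$, $r>0$. **Christ cubes.** For $\mu\in\mathcal F_Z$, fix a Christ decomposition of $(N,d_N,\mu_N)$: families $\mathcal Q_k$ ($k\in\mathbb Z$) of countably many pairwise disjoint open sets of $N$ ("cubes of generation $k$"), $\mathcal Q=\bigcup_k\mathcal Q_k$, and constants $\delta\in(0,1)$, $C_1,c>0$ such that: (i) $\mu_N(N\setminus\bigcup_{Q\in\mathcal Q_k}Q)=0$ for all $k$; (ii) each $Q\in\mathcal Q_k$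 is contained in a unique $p_N(Q)\in\mathcal Q_{k-1}$ and is disjoint from every other element of $\mathcal Q_{k-1}$; (iii) for each $Q\in\mathcal Q_k$ there is $n_Q\in Q$ with $B_N(n_Q,c\delta^k)\subset Q\subset B_N(n_Q,C_1\delta^k)$; (iv) $\mu_N(p_N(Q))\le C_1\mu_N(Q)$ and $s_N(Q):=\{Q'\in\mathcal Q:p_N(Q')=Q\}$ has at most $C_1$ elements. It is assumed that $C_1\ge3$ and $\#s_N(Q)\ge2$ for all $Q$. **Cylinders.** For $E\subset N$, $r>1$, $a\in A$: $P_{r,E}(a)=\{(n,1)\exp(tZ):n\in E,\ t\in U_r(a)\}$, $U_r(a)=(\log(a/r),\log(ar))$. Fix $\gamma\ge5$ and $\lambda>e^3/\delta$. $P_{r,Q}(a)$ with $Q\in\mathcal Q_k$ is *admissible* if either $r>e$ and $ar^2\le\delta^k\le\lambda ar^\gamma$ ( *large* ), or $1<r\le e$ and $ae^2\log r\le\delta^k\le\lambda ae^2\log r$ ( *small* ). *)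

theory Defs
  imports "HOL-Analysis.Analysis" "HOL-Algebra.Group"
begin

section \<open>Stratified groups in exponential coordinates\<close>

text \<open>
  A simply connected nilpotent Lie group is diffeomorphic to its Lie algebra through the
  exponential map. We use this to realise the group on the underlying vector space of its Lie
  algebra, with the exponential map being the identity. Hence an element of type \<^typ>\<open>'a\<close>
  is read as an element of the Lie algebra or as its exponential, and the Haar measure is
  \<^term>\<open>lborel\<close>. The Lie bracket is not a separate datum: it is computed from the group law.
\<close>

primrec C_k :: "nat \<Rightarrow> ('a::real_normed_vector \<Rightarrow> 'b::real_normed_vector) \<Rightarrow> bool" where
  "C_k 0 f \<longleftrightarrow> continuous_on UNIV f"
| "C_k (Suc k) f \<longleftrightarrow>
     (\<forall>x. f differentiable (at x)) \<and> (\<forall>v. C_k k (\<lambda>x. frechet_derivative f (at x) v))"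

definition smooth :: "('a::real_normed_vector \<Rightarrow> 'b::real_normed_vector) \<Rightarrow> bool" where
  "smooth f \<longleftrightarrow> (\<forall>k. C_k k f)"

definition adjoint_action ::
    "('a::real_normed_vector, 'm) monoid_scheme \<Rightarrow> 'a \<Rightarrow> 'a \<Rightarrow> 'a" where
  "adjoint_action N x v =
     vector_derivative (\<lambda>t. x \<otimes>\<^bsub>N\<^esub> (t *\<^sub>R v) \<otimes>\<^bsub>N\<^esub> inv\<^bsub>N\<^esub> x) (at 0)"

definition lie_bracket ::
    "('a::real_normed_vector, 'm) monoid_scheme \<Rightarrow> 'a \<Rightarrow> 'a \<Rightarrow> 'a" where
  "lie_bracket N u v = vector_derivative (\<lambda>s. adjoint_action N (s *\<^sub>R u) v) (at 0)"

definition left_invariant_field ::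
    "('a::real_normed_vector, 'm) monoid_scheme \<Rightarrow> 'a \<Rightarrow> 'a \<Rightarrow> 'a" where
  "left_invariant_field N v x = vector_derivative (\<lambda>t. x \<otimes>\<^bsub>N\<^esub> (t *\<^sub>R v)) (at 0)"

text \<open>
  The layers are \<open>layer N j\<close> for \<open>1 \<le> j \<le> step N\<close>, with basis \<open>frame N j i\<close> for
  \<open>1 \<le> i \<le> layer_dim N j\<close>. Values outside these index ranges are irrelevant.
\<close>

record 'a stratified = "'a monoid" +
  step :: nat
  layer :: "nat \<Rightarrow> 'a set"
  layer_dim :: "nat \<Rightarrow> nat"
  frame :: "nat \<Rightarrow> nat \<Rightarrow> 'a"

definition is_decomp :: "'a::real_vector stratified \<Rightarrow> 'a \<Rightarrow> (nat \<Rightarrow> 'a) \<Rightarrow> bool" where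
  "is_decomp N x Y \<longleftrightarrow> (\<forall>j\<in>{1..step N}. Y j \<in> layer N j) \<and> (\<forall>j. j \<notin> {1..step N} \<longrightarrow> Y j = 0)
     \<and> x = (\<Sum>j=1..step N. Y j)"

text \<open>
  The assumption \<open>exp_id\<close> says that the one-parameter subgroup with initial velocity \<open>v\<close> is
  \<open>t \<mapsto> t *\<^sub>R v\<close>, that is, that the exponential map is the identity.
\<close>

locale stratified_group = group N for N :: "'a::euclidean_space stratified" (structure) +
  assumes carrier_UNIV: "carrier N = UNIV"
    and smooth_mult: "smooth (\<lambda>(x, y). x \<otimes> y)"
    and exp_id: "(s *\<^sub>R v) \<otimes> (t *\<^sub>R v) = (s + t) *\<^sub>R v"
    and step_pos: "1 \<le> step N"
    and layer_subspace: "j \<in> {1..step N} \<Longrightarrow> subspace (layer N j)"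
    and direct_sum: "\<exists>!Y. is_decomp N x Y"
    and bracket_layer: "\<lbrakk>i \<in> {1..step N}; j \<in> {1..step N}; u \<in> layer N i; v \<in> layer N j\<rbrakk> \<Longrightarrow>
          lie_bracket N u v \<in> (if i + j \<le> step N then layer N (i + j) else {0})"
    and generating: "\<lbrakk>subspace H; layer N 1 \<subseteq> H; \<And>u v. \<lbrakk>u \<in> H; v \<in> H\<rbrakk> \<Longrightarrow> lie_bracket N u v \<in> H\<rbrakk> \<Longrightarrow>
          H = UNIV"
    and frame_inj: "j \<in> {1..step N} \<Longrightarrow> inj_on (frame N j) {1..layer_dim N j}"
    and frame_independent: "j \<in> {1..step N} \<Longrightarrow> independent (frame N j ` {1..layer_dim N j})"
    and frame_span: "j \<in> {1..step N} \<Longrightarrow> span (frame N j ` {1..layer_dim N j}) = layer N j"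

definition dil :: "'a::real_vector stratified \<Rightarrow> real \<Rightarrow> 'a \<Rightarrow> 'a" where
  "dil N a x = (\<Sum>j=1..step N. a ^ j *\<^sub>R (THE Y. is_decomp N x Y) j)"


section \<open>The Carnot--Caratheodory distance\<close>

text \<open>
  The second and third conditions say that \<open>\<gamma>\<close> is absolutely continuous and that its derivative
  is almost everywhere the combination of the horizontal frame with coefficients \<open>u\<close>.
\<close>

definition horizontal_curve ::
    "'a::euclidean_space stratified \<Rightarrow> (real \<Rightarrow> 'a) \<Rightarrow> (nat \<Rightarrow> real \<Rightarrow> real) \<Rightarrow> bool" where
  "horizontal_curve N \<gamma> u \<longleftrightarrow>
     continuous_on {0..1} \<gamma> \<and>
     (\<forall>i\<in>{1..layer_dim N 1}. u i absolutely_integrable_on {0..1}) \<and>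
     (\<forall>t\<in>{0..1}.
        ((\<lambda>s. \<Sum>i=1..layer_dim N 1. u i s *\<^sub>R left_invariant_field N (frame N 1 i) (\<gamma> s))
          has_integral (\<gamma> t - \<gamma> 0)) {0..t})"

definition cc_dist :: "'a::euclidean_space stratified \<Rightarrow> 'a \<Rightarrow> 'a \<Rightarrow> real" where
  "cc_dist N x y =
     Inf {integral {0..1} (\<lambda>t. sqrt (\<Sum>i=1..layer_dim N 1. (u i t)\<^sup>2)) | \<gamma> u.
            horizontal_curve N \<gamma> u \<and> \<gamma> 0 = x \<and> \<gamma> 1 = y}"

definition cc_ball :: "'a::euclidean_space stratified \<Rightarrow> 'a \<Rightarrow> real \<Rightarrow> 'a set" where
  "cc_ball N x r = {y. cc_dist N x y < r}"

definition doubling :: "'a::euclidean_space stratified \<Rightarrow> 'a measure \<Rightarrow> bool" where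
  "doubling N m \<longleftrightarrow>
     (\<forall>x. \<forall>r>0. cc_ball N x r \<in> sets m \<and> 0 < emeasure m (cc_ball N x r) \<and>
                emeasure m (cc_ball N x r) < \<infinity>) \<and>
     (\<forall>C>1. \<exists>D>1. \<forall>x. \<forall>r>0.
        emeasure m (cc_ball N x (C * r)) \<le> ennreal D * emeasure m (cc_ball N x r))"


section \<open>The solvable extension and flow measures\<close>

definition semidirect :: "'a::euclidean_space stratified \<Rightarrow> ('a \<times> real) monoid" where
  "semidirect N =
     \<lparr>carrier = UNIV \<times> {0<..},
      mult = (\<lambda>(n, a) (n', a'). (n \<otimes>\<^bsub>N\<^esub> dil N a n', a * a')),
      one = (\<one>\<^bsub>N\<^esub>, 1)\<rparr>"

text \<open>
  The Lie algebra of \<^term>\<open>semidirect N\<close>, its tangent space at the identity \<open>(\<one>, 1)\<close>, is the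
  whole of \<^typ>\<open>'a \<times> real\<close>. A vector of the \<open>frame\<close> corresponds to \<open>(frame N j i, 0)\<close>, and the
  generator \<open>X0\<close> of the dilations, with \<open>exp (t X0) = (\<one>, exp t)\<close>, to \<open>(0, 1)\<close>.
\<close>

definition X0 :: "'a::euclidean_space \<times> real" where
  "X0 = (0, 1)"

definition lie_exp :: "('b::real_normed_vector, 'm) monoid_scheme \<Rightarrow> 'b \<Rightarrow> 'b" where
  "lie_exp G Z =
     (THE \<gamma>. (\<forall>t. \<gamma> t \<in> carrier G) \<and> (\<forall>s t. \<gamma> (s + t) = \<gamma> s \<otimes>\<^bsub>G\<^esub> \<gamma> t) \<and>
             (\<gamma> has_vector_derivative Z) (at (0::real))) 1"

definition full_frame :: "'a::euclidean_space stratified \<Rightarrow> 'a set" where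
  "full_frame N = (\<Union>j\<in>{1..step N}. frame N j ` {1..layer_dim N j})"

text \<open>The scalar product for which \<open>X0\<close> and the \<open>(frame N j i, 0)\<close> are orthonormal.\<close>

definition scalar_prod ::
    "'a::euclidean_space stratified \<Rightarrow> 'a \<times> real \<Rightarrow> 'a \<times> real \<Rightarrow> real" where
  "scalar_prod N Z W =
     (\<Sum>b\<in>full_frame N. representation (full_frame N) (fst Z) b *
                         representation (full_frame N) (fst W) b)
     + snd Z * snd W"

definition \<Z> :: "'a::euclidean_space stratified \<Rightarrow> ('a \<times> real) set" where
  "\<Z> N = {Z. scalar_prod N Z X0 = 1}"

definition right_haar :: "('a::euclidean_space \<times> real) measure" where
  "right_haar = density (restrict_space lborel (UNIV \<times> {0<..})) (\<lambda>(n, a). ennreal (1 / a))"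

definition flow_measure ::
    "'a::euclidean_space stratified \<Rightarrow> 'a \<times> real \<Rightarrow> ('a \<times> real \<Rightarrow> real) \<Rightarrow>
     ('a \<times> real) measure \<Rightarrow> bool" where
  "flow_measure N Z \<phi> \<mu> \<longleftrightarrow>
     \<phi> \<in> borel_measurable right_haar \<and>
     (\<forall>x\<in>carrier (semidirect N). 0 \<le> \<phi> x) \<and>
     (\<forall>x\<in>carrier (semidirect N). \<forall>t.
        \<phi> x = \<phi> (x \<otimes>\<^bsub>semidirect N\<^esub> lie_exp (semidirect N) (t *\<^sub>R Z))) \<and>
     \<mu> = density right_haar (\<lambda>x. ennreal (\<phi> x))"

definition \<mu>\<^sub>N :: "('a::euclidean_space \<times> real \<Rightarrow> real) \<Rightarrow> 'a measure" where
  "\<mu>\<^sub>N \<phi> = density lborel (\<lambda>n. ennreal (\<phi> (n, 1)))"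

text \<open>
  Membership of \<open>\<mu>\<close> in the class of flow measures with doubling trace. The density is carried
  along since \<^term>\<open>\<mu>\<^sub>N\<close> is defined by it.
\<close>

definition doubling_flow_measure ::
    "'a::euclidean_space stratified \<Rightarrow> 'a \<times> real \<Rightarrow> ('a \<times> real \<Rightarrow> real) \<Rightarrow>
     ('a \<times> real) measure \<Rightarrow> bool" where
  "doubling_flow_measure N Z \<phi> \<mu> \<longleftrightarrow> flow_measure N Z \<phi> \<mu> \<and> doubling N (\<mu>\<^sub>N \<phi>)"


section \<open>Christ cubes\<close>

text \<open>
  \<open>\<Q> k\<close> is the family of cubes of generation \<open>k\<close>. Parents and children are taken relative to
  the generation.
\<close>

definition parent :: "(int \<Rightarrow> 'a set set) \<Rightarrow> int \<Rightarrow> 'a set \<Rightarrow> 'a set" where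
  "parent \<Q> k Q = (THE Q'. Q' \<in> \<Q> (k - 1) \<and> Q \<subseteq> Q')"

definition children :: "(int \<Rightarrow> 'a set set) \<Rightarrow> int \<Rightarrow> 'a set \<Rightarrow> 'a set set" where
  "children \<Q> k Q = {Q' \<in> \<Q> (k + 1). parent \<Q> (k + 1) Q' = Q}"

locale christ_cubes =
  fixes N :: "'a::euclidean_space stratified" and m :: "'a measure"
    and \<Q> :: "int \<Rightarrow> 'a set set" and \<delta> C1 c :: real
  assumes delta: "0 < \<delta>" "\<delta> < 1"
    and C1_ge: "3 \<le> C1"
    and c_pos: "0 < c"
    and countable_cubes: "countable (\<Q> k)"
    and open_cubes: "Q \<in> \<Q> k \<Longrightarrow> open Q"
    and disjoint_cubes: "disjoint (\<Q> k)"
    and cubes_cover: "emeasure m (UNIV - \<Union>(\<Q> k)) = 0"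
    and unique_parent: "Q \<in> \<Q> k \<Longrightarrow> \<exists>!Q'. Q' \<in> \<Q> (k - 1) \<and> Q \<subseteq> Q'"
    and disjoint_others: "\<lbrakk>Q \<in> \<Q> k; Q' \<in> \<Q> (k - 1); Q' \<noteq> parent \<Q> k Q\<rbrakk> \<Longrightarrow> Q \<inter> Q' = {}"
    and sandwich: "Q \<in> \<Q> k \<Longrightarrow>
          \<exists>n\<in>Q. cc_ball N n (c * \<delta> powi k) \<subseteq> Q \<and> Q \<subseteq> cc_ball N n (C1 * \<delta> powi k)"
    and parent_measure: "Q \<in> \<Q> k \<Longrightarrow> emeasure m (parent \<Q> k Q) \<le> ennreal C1 * emeasure m Q"
    and finite_children: "Q \<in> \<Q> k \<Longrightarrow> finite (children \<Q> k Q)"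
    and children_le: "Q \<in> \<Q> k \<Longrightarrow> real (card (children \<Q> k Q)) \<le> C1"
    and children_ge: "Q \<in> \<Q> k \<Longrightarrow> 2 \<le> card (children \<Q> k Q)"


section \<open>Admissible cylinders and the maximal operator\<close>

definition cylinder ::
    "'a::euclidean_space stratified \<Rightarrow> 'a \<times> real \<Rightarrow> real \<Rightarrow> 'a set \<Rightarrow> real \<Rightarrow> ('a \<times> real) set" where
  "cylinder N Z r E a =
     {(n, 1) \<otimes>\<^bsub>semidirect N\<^esub> lie_exp (semidirect N) (t *\<^sub>R Z) | n t.
        n \<in> E \<and> t \<in> {ln (a / r)<..<ln (a * r)}}"

definition large_params :: "real \<Rightarrow> real \<Rightarrow> real \<Rightarrow> int \<Rightarrow> real \<Rightarrow> real \<Rightarrow> bool" where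
  "large_params \<delta> \<gamma> lam k r a \<longleftrightarrow>
     exp 1 < r \<and> a * r\<^sup>2 \<le> \<delta> powi k \<and> \<delta> powi k \<le> lam * a * r powr \<gamma>"

definition small_params :: "real \<Rightarrow> real \<Rightarrow> int \<Rightarrow> real \<Rightarrow> real \<Rightarrow> bool" where
  "small_params \<delta> lam k r a \<longleftrightarrow>
     1 < r \<and> r \<le> exp 1 \<and> a * exp 2 * ln r \<le> \<delta> powi k \<and> \<delta> powi k \<le> lam * a * exp 2 * ln r"

definition admissible_cylinders ::
    "'a::euclidean_space stratified \<Rightarrow> 'a \<times> real \<Rightarrow> (int \<Rightarrow> 'a set set) \<Rightarrow>
     real \<Rightarrow> real \<Rightarrow> real \<Rightarrow> ('a \<times> real) set set" where
  "admissible_cylinders N Z \<Q> \<delta> \<gamma> lam =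
     {cylinder N Z r Q a | r Q a k.
        0 < a \<and> Q \<in> \<Q> k \<and> (large_params \<delta> \<gamma> lam k r a \<or> small_params \<delta> lam k r a)}"

definition maximal_op ::
    "'b measure \<Rightarrow> 'b set set \<Rightarrow> ('b \<Rightarrow> 'c::real_normed_vector) \<Rightarrow> 'b \<Rightarrow> ennreal" where
  "maximal_op \<mu> \<P> f x =
     (SUP P\<in>{P \<in> \<P>. x \<in> P}. (\<integral>\<^sup>+y\<in>P. ennreal (norm (f y)) \<partial>\<mu>) / emeasure \<mu> P)"

end

(*
  Along a flow line, the flow measure is the product of its trace on N and of dt: right translations
  of N preserve Lebesgue measure and the density is constant along the flow, so the cylinder over Q
  of parameters (a, r) has measure 2 log(r) times the trace measure of Q. The weak type inequality
  then follows from a Vitali covering argument. Two cubes are disjoint or nested, so a greedy choice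
  by increasing generation yields disjoint cylinders such that every other one meets a chosen one
  over a larger cube. Admissibility bounds the height of the former by max(gamma + 1 + log lambda,
  lambda e^3) times the height of the latter, and only a dilation in the flow direction is needed,
  which costs a factor of at most 3 max(...).

  Two facts about N itself are needed, neither of which is part of its definition here. Dilations
  are automorphisms of the group: a linear map that respects the Lie bracket intertwines the adjoint
  actions, hence the logarithmic derivatives of the exponential map, hence the group laws. The
  exponential map of the semidirect product is found by conjugating A with an element w of N; that
  every Z arises in this way follows from an open mapping theorem at 0 and homogeneity.
*)
theory Submission
  imports Defs
begin

section \<open>Adjoint action and Lie bracket\<close>

text \<open>The group law is known only to be smooth, with the rays \<open>t *\<^sub>R v\<close> as
  one-parameter subgroups; no formula for a product is at hand. Identities are therefore obtained by
  differentiating along rays at time 0. What replaces uniqueness for differential equations is that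
  a function of a real parameter is constant once all its translates have derivative 0 at time 0;
  auxiliary functions are built so that group identities carry the vanishing at 0 to every time.

  Contraction to 0 by dilations turns local facts at 0 into global ones, both for the Jacobian of a
  right translation and for the range of velocities.

  In the covering argument, a cylinder over a small cube may be taller than the one over a larger
  cube that it meets. Admissibility ties the height to the size of the cube only relative to the
  position \<open>a\<close>, so the overlap of the time intervals also has to serve for comparing
  positions. The factor 3 comes from 1 + 2 \<kappa> \<le> 3 \<kappa>, where \<kappa> \<ge> 1 bounds
  the ratio of heights. Openness of cylinders gives measurability of the superlevel set and the
  passage to finite families.\<close>

text \<open>The hypothesis is phrased through translates because a relation such as
  \<open>h (s + t) = L (h t)\<close>, with \<open>L\<close> linear and depending on
  \<open>s\<close>, delivers the derivative of a translate at 0 from that of \<open>h\<close> at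
  0.\<close>

lemma constant_if_shifted_derivative_zero:
  fixes h :: "real \<Rightarrow> 'b::real_normed_vector"
  assumes "\<And>s. ((\<lambda>t. h (s + t)) has_vector_derivative 0) (at 0)"
  shows "h s = h 0"
proof -
  have "(h has_vector_derivative 0) (at s)" for s
  proof -
    have 1: "((\<lambda>t. h (s + t)) has_derivative (\<lambda>_. 0)) (at (s - s))"
      using assms[of s] by (simp add: has_vector_derivative_def)
    have 2: "((\<lambda>t. t - s) has_derivative (\<lambda>t. t)) (at s)"
      by (auto intro!: derivative_eq_intros)
    show ?thesis
      using has_derivative_compose[where g = "\<lambda>t. h (s + t)", OF 2 1]
      by (simp add: has_vector_derivative_def)
  qed
  then have "(h has_derivative (\<lambda>_. 0)) (at x)" for x
    by (simp add: has_vector_derivative_def)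
  then show ?thesis
    using has_derivative_zero_unique[of UNIV h s 0] by simp
qed

lemma ray_has_vector_derivative:
  "((\<lambda>t. t *\<^sub>R v) has_vector_derivative v) (at t within S)"
  by (auto intro!: derivative_eq_intros)

lemma has_vector_derivative_along_ray:
  assumes "(f has_derivative f') (at 0)"
  shows "((\<lambda>t. f (t *\<^sub>R v)) has_vector_derivative f' v) (at 0)"
proof -
  have 1: "((\<lambda>t. t *\<^sub>R v) has_derivative (\<lambda>t. t *\<^sub>R v)) (at 0)"
    by (auto intro!: derivative_eq_intros)
  have 2: "(f has_derivative f') (at (0 *\<^sub>R v))"
    using assms by simp
  have "(\<lambda>t. f' (t *\<^sub>R v)) = (\<lambda>t. t *\<^sub>R f' v)"
    by (simp add: linear_cmul[OF has_derivative_linear[OF assms]])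
  then show ?thesis
    using has_derivative_compose[where g = f, OF 1 2] by (simp add: has_vector_derivative_def)
qed

lemma C_k_imp_differentiable: "C_k (Suc k) f \<Longrightarrow> f differentiable (at x)"
  by simp

lemma C_k_imp_continuous: "C_k k f \<Longrightarrow> continuous_on UNIV f"
  by (cases k) (auto intro: differentiable_imp_continuous_on simp: differentiable_on_def)

context stratified_group
begin

lemma in_carrier [simp]: "x \<in> carrier N"
  by (simp add: carrier_UNIV)

section \<open>Exponential coordinates and the differential of the product\<close>

lemma one_eq_0: "\<one> = 0"
proof -
  have "(0::'a) \<otimes> 0 = 0" using exp_id[of 0 0 0] by simp
  then show ?thesis by (simp add: l_cancel_one')
qed

lemma mult_0_left [simp]: "0 \<otimes> x = x"
  using l_one[of x] by (simp add: one_eq_0)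

lemma mult_0_right [simp]: "x \<otimes> 0 = x"
  using r_one[of x] by (simp add: one_eq_0)

lemma mult_minus_right [simp]: "x \<otimes> - x = 0"
  using exp_id[of 1 x "-1"] by simp

lemma mult_minus_left [simp]: "- x \<otimes> x = 0"
  using exp_id[of "-1" x 1] by simp

lemma inv_eq_minus: "inv x = - x"
  by (rule inv_equality) (auto simp: one_eq_0)

lemma mult_assoc: "x \<otimes> y \<otimes> z = x \<otimes> (y \<otimes> z)"
  by (simp add: m_assoc)

lemma minus_mult_cancel [simp]: "- x \<otimes> (x \<otimes> y) = y" "x \<otimes> (- x \<otimes> y) = y"
  by (simp_all flip: mult_assoc)

lemma mult_minus_cancel [simp]: "(y \<otimes> x) \<otimes> - x = y" "(y \<otimes> - x) \<otimes> x = y"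
  by (simp_all add: mult_assoc)

lemma minus_mult: "- (x \<otimes> y) = - y \<otimes> - x"
  using inv_mult_group[of x y] by (simp add: inv_eq_minus)

definition dmult :: "'a \<times> 'a \<Rightarrow> 'a \<times> 'a \<Rightarrow> 'a" where
  "dmult p = frechet_derivative (\<lambda>(x, y). x \<otimes> y) (at p)"

lemma has_derivative_mult_pair: "((\<lambda>(x, y). x \<otimes> y) has_derivative dmult p) (at p)"
  unfolding dmult_def
  using smooth_mult[unfolded smooth_def] C_k_imp_differentiable frechet_derivative_works by blast

lemma linear_dmult: "linear (dmult p)"
  using has_derivative_mult_pair has_derivative_linear by blast

lemma dmult_add: "dmult p (u, v) = dmult p (u, 0) + dmult p (0, v)"
  using linear_add[OF linear_dmult, of p "(u, 0)" "(0, v)"] by simp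

lemma continuous_on_dmult: "continuous_on UNIV (\<lambda>p. dmult p w)"
  unfolding dmult_def
  using smooth_mult[unfolded smooth_def, rule_format, of "Suc 0"]
  by (cases w) auto

lemma has_derivative_mult [derivative_intros]:
  assumes "(f has_derivative f') (at x within S)" "(g has_derivative g') (at x within S)"
  shows "((\<lambda>x. f x \<otimes> g x) has_derivative (\<lambda>h. dmult (f x, g x) (f' h, g' h))) (at x within S)"
  using has_derivative_compose[OF has_derivative_Pair[OF assms] has_derivative_mult_pair]
  by simp

lemma has_vector_derivative_mult:
  assumes "(f has_vector_derivative f') (at t)" "(g has_vector_derivative g') (at t)"
  shows "((\<lambda>t. f t \<otimes> g t) has_vector_derivative dmult (f t, g t) (f', g')) (at t)"
proof -
  have "((\<lambda>t. f t \<otimes> g t) has_derivative (\<lambda>h. dmult (f t, g t) (h *\<^sub>R f', h *\<^sub>R g'))) (at t)"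
    using assms by (intro has_derivative_mult) (auto simp: has_vector_derivative_def)
  moreover have "(\<lambda>h. dmult (f t, g t) (h *\<^sub>R f', h *\<^sub>R g')) = (\<lambda>h. h *\<^sub>R dmult (f t, g t) (f', g'))"
    using linear_cmul[OF linear_dmult, of _ _ "(f', g')"] by (simp add: fun_eq_iff)
  ultimately show ?thesis by (simp add: has_vector_derivative_def)
qed

lemma continuous_on_mult [continuous_intros]:
  assumes "continuous_on S f" "continuous_on S g"
  shows "continuous_on S (\<lambda>x. f x \<otimes> g x)"
proof -
  have "continuous_on UNIV (\<lambda>(x, y). x \<otimes> y)"
    using smooth_mult smooth_def C_k_imp_continuous by blast
  then have "continuous_on S ((\<lambda>(x, y). x \<otimes> y) \<circ> (\<lambda>x. (f x, g x)))"
    by (intro continuous_on_compose continuous_on_Pair assms) (auto intro: continuous_on_subset)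
  then show ?thesis by (simp add: o_def)
qed

lemma dmult_0_right: "dmult (x, 0) (u, 0) = u"
proof -
  have "((\<lambda>t. (x + t *\<^sub>R u) \<otimes> 0) has_vector_derivative dmult (x + 0 *\<^sub>R u, 0) (u, 0)) (at 0)"
    by (rule has_vector_derivative_mult) (auto intro!: derivative_eq_intros)
  moreover have "((\<lambda>t. (x + t *\<^sub>R u) \<otimes> 0) has_vector_derivative u) (at 0)"
    by (auto intro!: derivative_eq_intros)
  ultimately show ?thesis using vector_derivative_unique_at by force
qed

lemma dmult_0_left: "dmult (0, y) (0, v) = v"
proof -
  have "((\<lambda>t. 0 \<otimes> (y + t *\<^sub>R v)) has_vector_derivative dmult (0, y + 0 *\<^sub>R v) (0, v)) (at 0)"
    by (rule has_vector_derivative_mult) (auto intro!: derivative_eq_intros)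
  moreover have "((\<lambda>t. 0 \<otimes> (y + t *\<^sub>R v)) has_vector_derivative v) (at 0)"
    by (auto intro!: derivative_eq_intros)
  ultimately show ?thesis using vector_derivative_unique_at by force
qed

lemma dmult_0: "dmult (0, 0) (u, v) = u + v"
  by (simp add: dmult_add[of _ u v] dmult_0_right dmult_0_left)

text \<open>Multiples by natural numbers are powers in exponential coordinates, so \<open>c\<close>
  commutes with them. Hence \<open>c v\<close> is \<open>n\<close> times \<open>c (v / n)\<close>
  for every positive \<open>n\<close>, and these difference quotients tend to
  \<open>c' v\<close>.\<close>

lemma endomorphism_linear:
  assumes hom: "\<And>x y. c (x \<otimes> y) = c x \<otimes> c y" and diff: "(c has_derivative c') (at 0)"
  shows "c = c'"
proof
  fix v
  have scale: "c (real n *\<^sub>R w) = real n *\<^sub>R c w" for n w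
  proof (induction n)
    case 0
    have "c 0 \<otimes> c 0 = c 0" using hom[of 0 0] by simp
    then have "c 0 = 0" using l_cancel_one'[of "c 0" "c 0"] by (simp add: one_eq_0)
    then show ?case by simp
  next
    case (Suc n)
    have "c (real (Suc n) *\<^sub>R w) = c ((real n *\<^sub>R w) \<otimes> (1 *\<^sub>R w))"
      by (subst exp_id) (simp add: add.commute)
    also have "\<dots> = (real n *\<^sub>R c w) \<otimes> (1 *\<^sub>R c w)" by (simp add: hom Suc)
    also have "\<dots> = real (Suc n) *\<^sub>R c w" by (subst exp_id) (simp add: add.commute)
    finally show ?case .
  qed
  have c0: "c 0 = 0" using scale[of 0 0] by simp
  have "((\<lambda>t. c (t *\<^sub>R v)) has_vector_derivative c' v) (at 0)"
    by (rule has_vector_derivative_along_ray) fact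
  then have lim: "((\<lambda>t. (1 / t) *\<^sub>R c (t *\<^sub>R v)) \<longlongrightarrow> c' v) (at 0)"
  proof -
    assume "((\<lambda>t. c (t *\<^sub>R v)) has_vector_derivative c' v) (at 0)"
    then have "(\<lambda>h. norm (c (h *\<^sub>R v) - h *\<^sub>R c' v) / norm h) \<midarrow>0\<rightarrow> 0"
      by (simp add: has_vector_derivative_def has_derivative_at c0)
    then have "(\<lambda>h. norm ((1 / h) *\<^sub>R c (h *\<^sub>R v) - c' v)) \<midarrow>0\<rightarrow> 0"
    proof (rule Lim_transform_eventually)
      have "norm (c (h *\<^sub>R v) - h *\<^sub>R c' v) / norm h = norm ((1 / h) *\<^sub>R c (h *\<^sub>R v) - c' v)"
        if "h \<noteq> 0" for h
      proof -
        have "(1 / h) *\<^sub>R c (h *\<^sub>R v) - c' v = (1 / h) *\<^sub>R (c (h *\<^sub>R v) - h *\<^sub>R c' v)"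
          using that by (simp add: scaleR_diff_right)
        then show ?thesis by simp
      qed
      then show "\<forall>\<^sub>F h in at 0. norm (c (h *\<^sub>R v) - h *\<^sub>R c' v) / norm h
          = norm ((1 / h) *\<^sub>R c (h *\<^sub>R v) - c' v)"
        by (simp add: eventually_at_filter)
    qed
    then show ?thesis
      using LIM_zero_iff tendsto_norm_zero_iff by blast
  qed
  have "filterlim (\<lambda>n. 1 / real (Suc n)) (at 0) sequentially"
    by (rule filterlim_atI) (use LIMSEQ_Suc[OF lim_1_over_n[where ?'a = real]] in auto)
  from filterlim_compose[OF lim this]
  have "(\<lambda>n. real (Suc n) *\<^sub>R c ((1 / real (Suc n)) *\<^sub>R v)) \<longlonglongrightarrow> c' v"
    by (simp del: of_nat_Suc)
  moreover have "real (Suc n) *\<^sub>R c ((1 / real (Suc n)) *\<^sub>R v) = c v" for n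
    by (subst scale[symmetric]) (simp del: of_nat_Suc)
  ultimately have "(\<lambda>n::nat. c v) \<longlonglongrightarrow> c' v" by (simp del: of_nat_Suc)
  then show "c v = c' v" by (simp add: LIMSEQ_const_iff)
qed

text \<open>Conjugation in the group itself. In exponential coordinates it is already linear and
  coincides with the derivative that defines \<open>adjoint_action\<close>.\<close>

definition Ad :: "'a \<Rightarrow> 'a \<Rightarrow> 'a" where
  "Ad x y = x \<otimes> y \<otimes> - x"

lemma Ad_mult: "Ad x (y \<otimes> z) = Ad x y \<otimes> Ad x z"
  by (simp add: Ad_def mult_assoc)

lemma Ad_Ad: "Ad x (Ad y v) = Ad (x \<otimes> y) v"
  by (simp add: Ad_def mult_assoc minus_mult)

lemma Ad_0 [simp]: "Ad 0 v = v"
  by (simp add: Ad_def)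

lemma bounded_linear_Ad: "bounded_linear (Ad x)"
proof -
  have "\<exists>c'. (Ad x has_derivative c') (at 0)"
    unfolding Ad_def[abs_def] by (rule exI, (rule derivative_intros)+)
  then obtain c' where c': "(Ad x has_derivative c') (at 0)" by blast
  then have "Ad x = c'" by (intro endomorphism_linear Ad_mult)
  then show ?thesis using c' has_derivative_bounded_linear by blast
qed

lemmas Ad_linear = bounded_linear.linear[OF bounded_linear_Ad]

lemma Ad_of_0 [simp]: "Ad x 0 = 0"
  using linear_0[OF Ad_linear] .

lemma adjoint_action_eq_Ad: "adjoint_action N x v = Ad x v"
proof -
  have "((\<lambda>t. t *\<^sub>R Ad x v) has_vector_derivative Ad x v) (at 0)"
    by (auto intro!: derivative_eq_intros)
  then have "((\<lambda>t. Ad x (t *\<^sub>R v)) has_vector_derivative Ad x v) (at 0)"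
    by (simp add: linear_cmul[OF Ad_linear])
  then show ?thesis
    unfolding adjoint_action_def inv_eq_minus Ad_def[symmetric] by (rule vector_derivative_at)
qed

lemma Ad_differentiable: "\<exists>F. ((\<lambda>(z, w). Ad z w) has_derivative F) (at p)"
proof -
  have "\<exists>F. ((\<lambda>p. fst p \<otimes> snd p \<otimes> - fst p) has_derivative F) (at p)"
    by (rule exI, (rule derivative_intros)+)
  then show ?thesis by (simp add: Ad_def case_prod_unfold)
qed

text \<open>The differential of \<open>(z, w) \<mapsto> Ad z w\<close> at \<open>(0, w 0)\<close>
  splits into two partial differentials: along \<open>z\<close> it is the bracket by definition,
  along \<open>w\<close> it is the identity since \<open>Ad 0\<close> is.\<close>

lemma Ad_curve_derivative:
  assumes "(z has_vector_derivative z') (at 0)" "z 0 = 0" "(w has_vector_derivative w') (at 0)"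
  shows "((\<lambda>t. Ad (z t) (w t)) has_vector_derivative lie_bracket N z' (w 0) + w') (at 0)"
proof -
  obtain F where F: "((\<lambda>(z, w). Ad z w) has_derivative F) (at (0, w 0))"
    using Ad_differentiable by blast
  have lin: "linear F" using F has_derivative_linear by blast
  have gen: "((\<lambda>t. Ad (a t) (b t)) has_vector_derivative F (a', b')) (at 0)"
    if "(a has_vector_derivative a') (at 0)" "a 0 = 0" "(b has_vector_derivative b') (at 0)" "b 0 = w 0"
    for a b a' b'
  proof -
    have "((\<lambda>t. (a t, b t)) has_derivative (\<lambda>t. (t *\<^sub>R a', t *\<^sub>R b'))) (at 0)"
      using that by (intro has_derivative_Pair) (auto simp: has_vector_derivative_def)
    from has_derivative_compose[OF this, of "\<lambda>(z, w). Ad z w" F] F that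
    have "((\<lambda>t. Ad (a t) (b t)) has_derivative (\<lambda>t. F (t *\<^sub>R a', t *\<^sub>R b'))) (at 0)" by simp
    moreover have "(\<lambda>t. F (t *\<^sub>R a', t *\<^sub>R b')) = (\<lambda>t. t *\<^sub>R F (a', b'))"
      using linear_cmul[OF lin, of _ "(a', b')"] by (simp add: fun_eq_iff)
    ultimately show ?thesis by (simp add: has_vector_derivative_def)
  qed
  have "((\<lambda>s. Ad (s *\<^sub>R z') (w 0)) has_vector_derivative F (z', 0)) (at 0)"
    by (rule gen) (auto intro!: derivative_eq_intros)
  then have 1: "lie_bracket N z' (w 0) = F (z', 0)"
    unfolding lie_bracket_def adjoint_action_eq_Ad by (rule vector_derivative_at)
  have "((\<lambda>s. Ad 0 (w s)) has_vector_derivative F (0, w')) (at 0)"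
    by (rule gen[where a = "\<lambda>_. 0"]) (use assms in auto)
  then have 2: "w' = F (0, w')"
    using assms(3) vector_derivative_unique_at by fastforce
  have "F (z', w') = lie_bracket N z' (w 0) + w'"
    using linear_add[OF lin, of "(z', 0)" "(0, w')"] 1 2 by simp
  then show ?thesis using gen[OF assms] by simp
qed

lemma Ad_curve_derivative':
  assumes "(w has_vector_derivative w') (at 0)" "w 0 = y"
  shows "((\<lambda>t. Ad (t *\<^sub>R u) (w t)) has_vector_derivative lie_bracket N u y + w') (at 0)"
  using Ad_curve_derivative[OF ray_has_vector_derivative _ assms(1)] assms(2)
  by simp

lemma Ad_ray_derivative:
  "((\<lambda>t. Ad (t *\<^sub>R u) y) has_vector_derivative lie_bracket N u y) (at 0)"
  using Ad_curve_derivative'[of "\<lambda>_. y" 0 y u] by simp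

lemma lie_bracket_linear_right: "linear (lie_bracket N u)"
proof (rule linearI)
  fix v w and c :: real
  have "((\<lambda>t. Ad (t *\<^sub>R u) v + Ad (t *\<^sub>R u) w) has_vector_derivative lie_bracket N u v + lie_bracket N u w) (at 0)"
    by (intro derivative_intros Ad_ray_derivative)
  then show "lie_bracket N u (v + w) = lie_bracket N u v + lie_bracket N u w"
    using vector_derivative_unique_at[OF Ad_ray_derivative[of u "v + w"]]
    by (simp add: linear_add[OF Ad_linear])
  have "((\<lambda>t. c *\<^sub>R Ad (t *\<^sub>R u) v) has_vector_derivative c *\<^sub>R lie_bracket N u v) (at 0)"
    by (intro bounded_linear.has_vector_derivative[OF bounded_linear_scaleR_right] Ad_ray_derivative)
  then show "lie_bracket N u (c *\<^sub>R v) = c *\<^sub>R lie_bracket N u v"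
    using vector_derivative_unique_at[OF Ad_ray_derivative[of u "c *\<^sub>R v"]]
    by (simp add: linear_cmul[OF Ad_linear])
qed

text \<open>The bracket is defined ray by ray, so additivity in \<open>u\<close> is not visible
  there. It appears once the bracket is recognised as the Frechet derivative of
  \<open>z \<mapsto> Ad z v\<close> at 0.\<close>

lemma lie_bracket_linear_left: "linear (\<lambda>u. lie_bracket N u v)"
proof -
  obtain F where F: "((\<lambda>(z, w). Ad z w) has_derivative F) (at (0, v))"
    using Ad_differentiable by blast
  have "((\<lambda>z. (z, v)) has_derivative (\<lambda>z. (z, 0))) (at 0)"
    by (auto intro!: derivative_eq_intros)
  from has_derivative_compose[where g = "\<lambda>(z, w). Ad z w", OF this F]
  have "((\<lambda>z. Ad z v) has_derivative (\<lambda>z. F (z, 0))) (at 0)" by simp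
  then have G: "((\<lambda>z. Ad z v) has_derivative (\<lambda>z. F (z, 0))) (at 0)" "linear (\<lambda>z. F (z, 0))"
    using has_derivative_linear by blast+
  have "lie_bracket N u v = F (u, 0)" for u
    using vector_derivative_unique_at[OF Ad_ray_derivative has_vector_derivative_along_ray[OF G(1)]] .
  then show ?thesis using G(2) by simp
qed

end

section \<open>Linear maps that respect the bracket are automorphisms\<close>

text \<open>At 0 the product rule only sees the value \<open>J 0\<close>, so continuity of
  \<open>J\<close> suffices. This is meant for \<open>log_deriv\<close>, of whose dependence on the
  base point only continuity is used.\<close>

lemma scaleR_has_vector_derivative_at_0:
  fixes J :: "real \<Rightarrow> 'b::real_normed_vector"
  assumes "continuous (at 0) J"
  shows "((\<lambda>h. h *\<^sub>R J h) has_vector_derivative J 0) (at 0)"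
proof -
  have "(\<lambda>h. norm (h *\<^sub>R J h - h *\<^sub>R J 0) / norm h) \<midarrow>0\<rightarrow> 0"
  proof (rule Lim_transform_eventually)
    show "(\<lambda>h. norm (J h - J 0)) \<midarrow>0\<rightarrow> 0"
      using assms by (simp add: continuous_at LIM_zero tendsto_norm_zero)
    have "norm (J h - J 0) = norm (h *\<^sub>R J h - h *\<^sub>R J 0) / norm h" if "h \<noteq> 0" for h
      using that by (simp flip: scaleR_diff_right)
    then show "\<forall>\<^sub>F h in at 0. norm (J h - J 0) = norm (h *\<^sub>R J h - h *\<^sub>R J 0) / norm h"
      by (simp add: eventually_at_filter)
  qed
  then show ?thesis
    by (simp add: has_vector_derivative_def has_derivative_at bounded_linear_scaleR_left)
qed

context stratified_group
begin

text \<open>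
  The logarithmic derivative of the identity, that is, the left Maurer--Cartan form in
  exponential coordinates.
\<close>

definition log_deriv :: "'a \<Rightarrow> 'a \<Rightarrow> 'a" where
  "log_deriv x v = dmult (- x, x) (0, v)"

lemma log_deriv_0 [simp]: "log_deriv 0 v = v"
  by (simp add: log_deriv_def dmult_0)

lemma linear_log_deriv: "linear (log_deriv x)"
proof -
  have "linear (\<lambda>v. (0, v) :: 'a \<times> 'a)" by (rule linearI) auto
  from linear_compose[OF this linear_dmult] show ?thesis
    by (simp add: o_def log_deriv_def[abs_def])
qed

lemma curve_log_deriv:
  assumes "(c has_vector_derivative v) (at t)"
  shows "((\<lambda>s. - c t \<otimes> c s) has_vector_derivative log_deriv (c t) v) (at t)"
  unfolding log_deriv_def
  by (rule has_vector_derivative_mult[OF has_vector_derivative_const assms])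

text \<open>Left translations by \<open>- x\<close> and \<open>x\<close> undo each other. Together
  with \<open>log_deriv_dmult\<close> this makes \<open>log_deriv x\<close> the inverse of the map
  that extends a vector to a left-invariant field and evaluates it at \<open>x\<close>.\<close>

lemma dmult_log_deriv: "dmult (x, 0) (0, log_deriv x v) = v"
proof -
  define c where "c = (\<lambda>t. x + t *\<^sub>R v)"
  have c: "(c has_vector_derivative v) (at 0)"
    unfolding c_def by (auto intro!: derivative_eq_intros)
  have "((\<lambda>t. x \<otimes> (- c 0 \<otimes> c t)) has_vector_derivative
      dmult (x, - c 0 \<otimes> c 0) (0, log_deriv (c 0) v)) (at 0)"
    by (rule has_vector_derivative_mult[OF has_vector_derivative_const curve_log_deriv[OF c]])
  then have "(c has_vector_derivative dmult (x, 0) (0, log_deriv x v)) (at 0)"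
    by (simp add: c_def)
  then show ?thesis using c vector_derivative_unique_at by blast
qed

lemma log_deriv_dmult: "log_deriv x (dmult (x, 0) (0, w)) = w"
proof -
  have "((\<lambda>t. x \<otimes> t *\<^sub>R w) has_vector_derivative dmult (x, 0 *\<^sub>R w) (0, w)) (at 0)"
    by (rule has_vector_derivative_mult[OF has_vector_derivative_const ray_has_vector_derivative])
  from curve_log_deriv[OF this] have "((\<lambda>t. t *\<^sub>R w) has_vector_derivative log_deriv x (dmult (x, 0) (0, w))) (at 0)"
    by simp
  then show ?thesis using ray_has_vector_derivative vector_derivative_unique_at by blast
qed

text \<open>Leibniz rule for the left logarithmic derivative of a product, applied to
  \<open>(s + h) *\<^sub>R y = s *\<^sub>R y \<otimes> h *\<^sub>R y\<close> with \<open>y\<close>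
  varied from \<open>x\<close> in direction \<open>v\<close>. The contribution of the first factor
  is conjugated past the second.\<close>

lemma log_deriv_ray_add:
  "log_deriv ((s + h) *\<^sub>R x) ((s + h) *\<^sub>R v) =
     Ad (- (h *\<^sub>R x)) (log_deriv (s *\<^sub>R x) (s *\<^sub>R v)) + log_deriv (h *\<^sub>R x) (h *\<^sub>R v)"
proof -
  define c where "c = (\<lambda>s \<epsilon>. s *\<^sub>R (x + \<epsilon> *\<^sub>R v))"
  define d where "d = (\<lambda>s \<epsilon>. - c s 0 \<otimes> c s \<epsilon>)"
  have c: "(c s has_vector_derivative s *\<^sub>R v) (at 0)" for s
    unfolding c_def by (auto intro!: derivative_eq_intros)
  have d: "(d s has_vector_derivative log_deriv (s *\<^sub>R x) (s *\<^sub>R v)) (at 0)" for s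
    using curve_log_deriv[OF c[of s]] by (simp add: d_def c_def)
  have "((\<lambda>\<epsilon>. Ad (- (h *\<^sub>R x)) (d s \<epsilon>) \<otimes> d h \<epsilon>) has_vector_derivative
     dmult (Ad (- (h *\<^sub>R x)) (d s 0), d h 0)
       (Ad (- (h *\<^sub>R x)) (log_deriv (s *\<^sub>R x) (s *\<^sub>R v)), log_deriv (h *\<^sub>R x) (h *\<^sub>R v))) (at 0)"
    by (intro has_vector_derivative_mult bounded_linear.has_vector_derivative[OF bounded_linear_Ad] d)
  moreover have "d s 0 = 0" for s by (simp add: d_def)
  moreover have "(\<lambda>\<epsilon>. Ad (- (h *\<^sub>R x)) (d s \<epsilon>) \<otimes> d h \<epsilon>) = d (s + h)"
  proof
    fix \<epsilon>
    have "c (s + h) \<epsilon> = c s \<epsilon> \<otimes> c h \<epsilon>" for \<epsilon>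
      by (simp add: c_def exp_id)
    moreover have "c h 0 = h *\<^sub>R x" by (simp add: c_def)
    ultimately show "Ad (- (h *\<^sub>R x)) (d s \<epsilon>) \<otimes> d h \<epsilon> = d (s + h) \<epsilon>"
      by (simp add: d_def Ad_def minus_mult mult_assoc)
  qed
  ultimately have "(d (s + h) has_vector_derivative Ad (- (h *\<^sub>R x)) (log_deriv (s *\<^sub>R x) (s *\<^sub>R v))
      + log_deriv (h *\<^sub>R x) (h *\<^sub>R v)) (at 0)"
    by (simp add: dmult_0)
  then show ?thesis using d vector_derivative_unique_at by blast
qed

lemma log_deriv_ray_derivative:
  "((\<lambda>h. log_deriv (h *\<^sub>R x) (h *\<^sub>R v)) has_vector_derivative v) (at 0)"
proof -
  have "continuous_on UNIV (\<lambda>h::real. dmult (- (h *\<^sub>R x), h *\<^sub>R x) (0, v))"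
    by (rule continuous_on_compose2[OF continuous_on_dmult]) (auto intro!: continuous_intros)
  then have "continuous (at 0) (\<lambda>h::real. dmult (- (h *\<^sub>R x), h *\<^sub>R x) (0, v))"
    by (simp add: continuous_on_eq_continuous_at)
  from scaleR_has_vector_derivative_at_0[OF this] show ?thesis
    by (simp add: linear_cmul[OF linear_log_deriv] dmult_0 flip: log_deriv_def)
qed

context
  fixes \<psi> :: "'a \<Rightarrow> 'a"
  assumes \<psi>_linear: "linear \<psi>"
    and \<psi>_bracket: "\<And>u v. \<psi> (lie_bracket N u v) = lie_bracket N (\<psi> u) (\<psi> v)"
begin

lemma bounded_linear_bracket_hom: "bounded_linear \<psi>"
  using \<psi>_linear linear_conv_bounded_linear by blast

text \<open>\<open>h s\<close> is \<open>\<psi>\<close> preceded by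
  \<open>Ad (s *\<^sub>R x)\<close> and followed by the inverse of
  \<open>Ad (s *\<^sub>R \<psi> x)\<close>. Its derivative at 0 is
  \<open>\<psi> [x, y] - [\<psi> x, \<psi> y] = 0\<close>, so its values at 0 and 1 agree.\<close>

lemma bracket_hom_Ad: "\<psi> (Ad x y) = Ad (\<psi> x) (\<psi> y)"
proof -
  define h where "h = (\<lambda>s y. Ad (s *\<^sub>R - \<psi> x) (\<psi> (Ad (s *\<^sub>R x) y)))"
  have "((\<lambda>s. h s y) has_vector_derivative 0) (at 0)" for y
  proof -
    have "((\<lambda>s. \<psi> (Ad (s *\<^sub>R x) y)) has_vector_derivative \<psi> (lie_bracket N x y)) (at 0)"
      by (rule bounded_linear.has_vector_derivative[OF bounded_linear_bracket_hom Ad_ray_derivative])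
    from Ad_curve_derivative'[OF this, of "\<psi> y" "- \<psi> x"] show ?thesis
      by (simp add: h_def \<psi>_bracket linear_neg[OF lie_bracket_linear_left])
  qed
  moreover have "h (s + t) y = Ad (s *\<^sub>R - \<psi> x) (h t (Ad (s *\<^sub>R x) y))" for s t
  proof -
    have "Ad (t *\<^sub>R x) (Ad (s *\<^sub>R x) y) = Ad ((s + t) *\<^sub>R x) y"
      by (simp only: Ad_Ad exp_id add.commute)
    moreover have "Ad (s *\<^sub>R - \<psi> x) (Ad (t *\<^sub>R - \<psi> x) z) = Ad ((s + t) *\<^sub>R - \<psi> x) z" for z
      by (simp only: Ad_Ad exp_id)
    ultimately show ?thesis by (simp only: h_def)
  qed
  ultimately have "((\<lambda>t. h (s + t) y) has_vector_derivative Ad (s *\<^sub>R - \<psi> x) 0) (at 0)" for s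
    by (simp only: bounded_linear.has_vector_derivative[OF bounded_linear_Ad])
  then have "h 1 y = h 0 y"
    by (intro constant_if_shifted_derivative_zero[of "\<lambda>s. h s y"]) simp
  then have "Ad (- \<psi> x) (\<psi> (Ad x y)) = \<psi> y" by (simp add: h_def)
  then have "Ad (\<psi> x) (Ad (- \<psi> x) (\<psi> (Ad x y))) = Ad (\<psi> x) (\<psi> y)" by simp
  then show ?thesis by (simp add: Ad_Ad)
qed

text \<open>The defect \<open>k\<close> along the ray inherits the twisted addition rule of
  \<open>log_deriv_ray_add\<close>. Untwisting it by \<open>Ad (s *\<^sub>R \<psi> x)\<close> gives
  \<open>K\<close>, for which \<open>K (s + h) - K s\<close> is a linear image of
  \<open>K h\<close>; hence the derivative of \<open>K\<close> at 0 governs all times.\<close>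

lemma bracket_hom_log_deriv: "\<psi> (log_deriv x v) = log_deriv (\<psi> x) (\<psi> v)"
proof -
  define k where
    "k = (\<lambda>s. \<psi> (log_deriv (s *\<^sub>R x) (s *\<^sub>R v)) - log_deriv (s *\<^sub>R \<psi> x) (s *\<^sub>R \<psi> v))"
  define K where "K = (\<lambda>s. Ad (s *\<^sub>R \<psi> x) (k s))"
  have k0: "k 0 = 0" by (simp add: k_def linear_0[OF \<psi>_linear])
  have k_add: "k (s + h) = Ad (- (h *\<^sub>R \<psi> x)) (k s) + k h" for s h
    unfolding k_def log_deriv_ray_add
    by (simp add: linear_add[OF \<psi>_linear] bracket_hom_Ad linear_diff[OF Ad_linear]
        linear_neg[OF \<psi>_linear] linear_cmul[OF \<psi>_linear])
  have "(k has_vector_derivative \<psi> v - \<psi> v) (at 0)"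
    unfolding k_def
    by (intro derivative_intros log_deriv_ray_derivative
        bounded_linear.has_vector_derivative[OF bounded_linear_bracket_hom])
  then have K0: "(K has_vector_derivative 0) (at 0)"
    using Ad_curve_derivative'[of k 0 0 "\<psi> x"] k0
    by (simp add: K_def linear_0[OF lie_bracket_linear_right])
  have "K (s + h) = K s + Ad (s *\<^sub>R \<psi> x) (K h)" for s h
  proof -
    have "Ad ((s + h) *\<^sub>R \<psi> x) (Ad (- (h *\<^sub>R \<psi> x)) (k s)) = Ad (s *\<^sub>R \<psi> x) (k s)"
      using exp_id[of "s + h" "\<psi> x" "- h"] by (simp add: Ad_Ad)
    then show ?thesis
      by (simp add: K_def k_add linear_add[OF Ad_linear] Ad_Ad exp_id)
  qed
  then have "((\<lambda>h. K (s + h)) has_vector_derivative 0) (at 0)" for s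
    using bounded_linear.has_vector_derivative[OF bounded_linear_Ad K0, of "s *\<^sub>R \<psi> x"]
    by (auto intro!: derivative_eq_intros)
  then have "K 1 = K 0" by (rule constant_if_shifted_derivative_zero)
  then have "Ad (- \<psi> x) (Ad (\<psi> x) (k 1)) = Ad (- \<psi> x) 0" by (simp add: K_def k0)
  then have "k 1 = 0" by (simp add: Ad_Ad)
  then show ?thesis by (simp add: k_def)
qed

text \<open>The curves \<open>\<psi> (x \<otimes> s *\<^sub>R y)\<close> and
  \<open>\<psi> x \<otimes> s *\<^sub>R \<psi> y\<close> start at the same point and follow the same
  left-invariant field. Dividing the first by the one-parameter subgroup of \<open>\<psi> y\<close>
  gives \<open>q\<close>, which is therefore constant.\<close>

lemma bracket_hom_mult: "\<psi> (x \<otimes> y) = \<psi> x \<otimes> \<psi> y"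
proof -
  define q where "q = (\<lambda>s. \<psi> (x \<otimes> s *\<^sub>R y) \<otimes> (- s) *\<^sub>R \<psi> y)"
  have "((\<lambda>h. q (s + h)) has_vector_derivative 0) (at 0)" for s
  proof -
    define z where "z = x \<otimes> s *\<^sub>R y"
    define w where "w = dmult (z, 0) (0, y)"
    \<comment> \<open>\<open>w\<close> is the value at \<open>z\<close> of the left-invariant field
      of \<open>y\<close>, so its logarithmic derivative is \<open>y\<close>; compatibility of
      \<open>\<psi>\<close> with \<open>log_deriv\<close> carries this field to that of
      \<open>\<psi> y\<close>.\<close>
    have \<psi>w: "\<psi> w = dmult (\<psi> z, 0) (0, \<psi> y)"
      using bracket_hom_log_deriv[of z w] dmult_log_deriv[of "\<psi> z" "\<psi> w"]
      by (simp add: w_def log_deriv_dmult)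
    have "((\<lambda>h. z \<otimes> h *\<^sub>R y) has_vector_derivative dmult (z, 0 *\<^sub>R y) (0, y)) (at 0)"
      by (rule has_vector_derivative_mult[OF has_vector_derivative_const ray_has_vector_derivative])
    then have "((\<lambda>h. \<psi> (z \<otimes> h *\<^sub>R y)) has_vector_derivative \<psi> w) (at 0)"
      unfolding w_def scaleR_zero_left
      by (rule bounded_linear.has_vector_derivative[OF bounded_linear_bracket_hom])
    from has_vector_derivative_mult[OF this ray_has_vector_derivative[of "- \<psi> y"]]
    have "((\<lambda>h. \<psi> (z \<otimes> h *\<^sub>R y) \<otimes> h *\<^sub>R - \<psi> y) has_vector_derivative
        dmult (\<psi> z, 0) (\<psi> w, - \<psi> y)) (at 0)"
      by simp
    moreover have "dmult (\<psi> z, 0) (\<psi> w, - \<psi> y) = 0"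
    proof -
      have "dmult (\<psi> z, 0) (\<psi> w, - \<psi> y) = dmult (\<psi> z, 0) (\<psi> w, 0) + dmult (\<psi> z, 0) (0, - \<psi> y)"
        by (rule dmult_add)
      also have "\<dots> = 0"
        using linear_neg[OF linear_dmult, of "(\<psi> z, 0)" "(0, \<psi> y)"] by (simp add: dmult_0_right \<psi>w)
      finally show ?thesis .
    qed
    ultimately have "((\<lambda>h. \<psi> (z \<otimes> h *\<^sub>R y) \<otimes> h *\<^sub>R - \<psi> y) has_vector_derivative 0) (at 0)"
      by simp
    from has_vector_derivative_mult[OF this has_vector_derivative_const[of "s *\<^sub>R - \<psi> y"]]
    have "((\<lambda>h. \<psi> (z \<otimes> h *\<^sub>R y) \<otimes> h *\<^sub>R - \<psi> y \<otimes> s *\<^sub>R - \<psi> y) has_vector_derivative 0) (at 0)"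
      using linear_0[OF linear_dmult] by (simp flip: zero_prod_def)
    moreover have "\<psi> (z \<otimes> h *\<^sub>R y) \<otimes> h *\<^sub>R - \<psi> y \<otimes> s *\<^sub>R - \<psi> y = q (s + h)" for h
    proof -
      have "z \<otimes> h *\<^sub>R y = x \<otimes> (s + h) *\<^sub>R y"
        by (simp only: z_def mult_assoc exp_id)
      moreover have "h *\<^sub>R - \<psi> y \<otimes> s *\<^sub>R - \<psi> y = (- (s + h)) *\<^sub>R \<psi> y"
        by (simp only: exp_id) (simp add: algebra_simps)
      ultimately show ?thesis by (simp only: q_def mult_assoc)
    qed
    ultimately show ?thesis by simp
  qed
  then have "q 1 = q 0" by (rule constant_if_shifted_derivative_zero)
  then have "\<psi> (x \<otimes> y) \<otimes> - \<psi> y \<otimes> \<psi> y = \<psi> x \<otimes> \<psi> y" by (simp add: q_def)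
  then show ?thesis by simp
qed

end

end

section \<open>Dilations and one-parameter subgroups\<close>

context stratified_group
begin

section \<open>Projections onto the layers and dilations\<close>

definition component :: "nat \<Rightarrow> 'a \<Rightarrow> 'a" where
  "component j x = (THE Y. is_decomp N x Y) j"

lemma is_decomp_component: "is_decomp N x (\<lambda>j. component j x)"
  unfolding component_def using theI'[OF direct_sum[of x]] by simp

lemma component_unique: "is_decomp N x Y \<Longrightarrow> component j x = Y j"
  unfolding component_def using the1_equality[OF direct_sum[of x]] by metis

lemma component_in_layer: "j \<in> {1..step N} \<Longrightarrow> component j x \<in> layer N j"
  using is_decomp_component[of x] by (simp add: is_decomp_def)

lemma component_outside: "j \<notin> {1..step N} \<Longrightarrow> component j x = 0"
  using is_decomp_component[of x] unfolding is_decomp_def by blast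

lemma sum_component: "(\<Sum>j=1..step N. component j x) = x"
  using is_decomp_component[of x] unfolding is_decomp_def by metis

lemma is_decomp_scaled_components:
  "is_decomp N (\<Sum>j=1..step N. c j *\<^sub>R component j x) (\<lambda>j. c j *\<^sub>R component j x)"
  unfolding is_decomp_def
  by (simp add: component_outside subspace_scale[OF layer_subspace component_in_layer])

lemma component_scaled_sum:
  "component i (\<Sum>j=1..step N. c j *\<^sub>R component j x) = c i *\<^sub>R component i x"
  by (rule component_unique[OF is_decomp_scaled_components])

lemma linear_component: "linear (component j)"
proof (rule linearI)
  fix x y :: 'a and c :: real
  have "is_decomp N (x + y) (\<lambda>j. component j x + component j y)"
    unfolding is_decomp_def
    by (simp del: One_nat_def add: sum.distrib component_outside sum_component
        subspace_add[OF layer_subspace component_in_layer component_in_layer])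
  then show "component j (x + y) = component j x + component j y"
    by (rule component_unique)
  have "(\<Sum>j=1..step N. c *\<^sub>R component j x) = c *\<^sub>R x"
    by (simp del: One_nat_def add: sum_component flip: scaleR_sum_right)
  then show "component j (c *\<^sub>R x) = c *\<^sub>R component j x"
    using component_scaled_sum[of j "\<lambda>_. c" x] by (simp only:)
qed

lemma linear_scaled_components: "linear (\<lambda>x. \<Sum>j=1..step N. c j *\<^sub>R component j x)"
  using linear_component by (auto simp: linear_iff scaleR_add_right sum.distrib scaleR_sum_right mult.commute)

lemma dil_eq: "dil N a x = (\<Sum>j=1..step N. a ^ j *\<^sub>R component j x)"
  by (simp add: dil_def component_def)

lemma component_dil: "component i (dil N a x) = a ^ i *\<^sub>R component i x"
  by (simp only: dil_eq component_scaled_sum)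

lemma linear_dil: "linear (dil N a)"
  unfolding dil_eq[abs_def] by (rule linear_scaled_components)

lemma bounded_linear_dil: "bounded_linear (dil N a)"
  using linear_dil linear_conv_bounded_linear by blast

lemma dil_minus [simp]: "dil N a (- x) = - dil N a x"
  by (rule linear_neg[OF linear_dil])

lemma dil_of_0 [simp]: "dil N a 0 = 0"
  by (rule linear_0[OF linear_dil])

lemma dil_dil: "dil N a (dil N b x) = dil N (a * b) x"
  unfolding dil_eq[of a "dil N b x"] dil_eq[of "a * b"]
  by (simp add: component_dil power_mult_distrib)

lemma dil_1 [simp]: "dil N 1 x = x"
  by (simp del: One_nat_def add: dil_eq sum_component)

lemma dil_0 [simp]: "dil N 0 x = 0"
  by (auto simp: dil_eq intro!: sum.neutral)

lemma dil_layer: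
  assumes "j \<in> {1..step N}" "v \<in> layer N j"
  shows "dil N a v = a ^ j *\<^sub>R v"
proof -
  have "is_decomp N v (\<lambda>i. if i = j then v else 0)"
    unfolding is_decomp_def using assms by (auto simp: subspace_0[OF layer_subspace])
  then have c: "component i v = (if i = j then v else 0)" for i
    by (rule component_unique)
  show ?thesis
    unfolding dil_eq c using assms(1) by (simp add: if_distrib[of "(*\<^sub>R) _"] cong: if_cong)
qed

lemma continuous_dil: "continuous_on S (\<lambda>a. dil N a x)"
  unfolding dil_eq by (intro continuous_intros)

text \<open>On layers \<open>i\<close> and \<open>j\<close> both sides are
  \<open>a ^ (i + j)\<close> times the bracket, which is 0 if \<open>i + j\<close> exceeds the step.
  Bilinearity does the rest.\<close>

lemma dil_lie_bracket: "dil N a (lie_bracket N u v) = lie_bracket N (dil N a u) (dil N a v)"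
proof -
  let ?I = "{1..step N}"
  have layers: "dil N a (lie_bracket N p q) = lie_bracket N (dil N a p) (dil N a q)"
    if ij: "i \<in> ?I" "j \<in> ?I" "p \<in> layer N i" "q \<in> layer N j" for i j p q
  proof -
    have "lie_bracket N (dil N a p) (dil N a q) = a ^ (i + j) *\<^sub>R lie_bracket N p q"
      using ij by (simp add: dil_layer linear_cmul[OF lie_bracket_linear_left]
          linear_cmul[OF lie_bracket_linear_right] power_add)
    also have "\<dots> = dil N a (lie_bracket N p q)"
      using bracket_layer[OF ij] dil_layer[of "i + j"] ij by (auto split: if_splits)
    finally show ?thesis ..
  qed
  have expand: "lie_bracket N (\<Sum>i\<in>?I. p i) (\<Sum>j\<in>?I. q j) = (\<Sum>i\<in>?I. \<Sum>j\<in>?I. lie_bracket N (p i) (q j))"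
    for p q
    unfolding linear_sum[OF lie_bracket_linear_left, where g = p]
    by (intro sum.cong refl linear_sum[OF lie_bracket_linear_right])
  have dil_sum: "dil N a x = (\<Sum>j\<in>?I. dil N a (component j x))" for x
    by (subst sum_component[of x, symmetric]) (simp add: linear_sum[OF linear_dil] o_def)
  have "dil N a (lie_bracket N u v)
      = dil N a (lie_bracket N (\<Sum>i\<in>?I. component i u) (\<Sum>j\<in>?I. component j v))"
    by (simp only: sum_component)
  also have "\<dots> = (\<Sum>i\<in>?I. \<Sum>j\<in>?I. dil N a (lie_bracket N (component i u) (component j v)))"
    by (simp only: expand linear_sum[OF linear_dil] o_def)
  also have "\<dots> = (\<Sum>i\<in>?I. \<Sum>j\<in>?I. lie_bracket N (dil N a (component i u)) (dil N a (component j v)))"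
  proof (intro sum.cong refl)
    fix i j assume ij: "i \<in> ?I" "j \<in> ?I"
    show "dil N a (lie_bracket N (component i u) (component j v))
        = lie_bracket N (dil N a (component i u)) (dil N a (component j v))"
      by (rule layers[OF ij component_in_layer[OF ij(1)] component_in_layer[OF ij(2)]])
  qed
  also have "\<dots> = lie_bracket N (dil N a u) (dil N a v)"
    unfolding dil_sum[of u] dil_sum[of v] by (rule expand[symmetric])
  finally show ?thesis .
qed

lemma dil_mult: "dil N a (x \<otimes> y) = dil N a x \<otimes> dil N a y"
  by (rule bracket_hom_mult[OF linear_dil dil_lie_bracket])

section \<open>Velocities of conjugated dilation groups\<close>

text \<open>The derivation of the Lie algebra that generates the dilations.\<close>

definition grading :: "'a \<Rightarrow> 'a" where
  "grading x = (\<Sum>j=1..step N. real j *\<^sub>R component j x)"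

lemma bounded_linear_grading: "bounded_linear grading"
  unfolding grading_def[abs_def]
  by (rule linear_conv_bounded_linear[THEN iffD1, OF linear_scaled_components])

lemma dil_exp_derivative:
  "((\<lambda>s. dil N (exp (t * s)) x) has_vector_derivative t *\<^sub>R grading x) (at 0)"
proof -
  have "((\<lambda>s. exp (t * s) ^ j) has_real_derivative real j * t) (at 0)" for j
    by (auto intro!: derivative_eq_intros)
  then have "((\<lambda>s. exp (t * s) ^ j *\<^sub>R component j x) has_vector_derivative (real j * t) *\<^sub>R component j x) (at 0)" for j
    by (intro has_vector_derivative_real_field derivative_eq_intros)
      (auto intro!: derivative_eq_intros simp: has_real_derivative_iff_has_vector_derivative)
  then have "((\<lambda>s. \<Sum>j=1..step N. exp (t * s) ^ j *\<^sub>R component j x) has_vector_derivative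
     (\<Sum>j=1..step N. (real j * t) *\<^sub>R component j x)) (at 0)"
    by (intro has_vector_derivative_sum)
  then show ?thesis
    by (simp add: dil_eq grading_def scaleR_sum_right mult.commute)
qed

text \<open>
  The \<open>N\<close>-part of the velocity of the one-parameter group that arises from \<open>A\<close> by conjugation
  with \<open>w\<close>.
\<close>

definition conj_velocity :: "'a \<Rightarrow> 'a" where
  "conj_velocity w = dmult (w, - w) (0, - grading w)"

lemma conj_dil_derivative:
  "((\<lambda>s. w \<otimes> dil N (exp (t * s)) (- w)) has_vector_derivative t *\<^sub>R conj_velocity w) (at 0)"
proof -
  have "((\<lambda>s. w \<otimes> dil N (exp (t * s)) (- w)) has_vector_derivative
      dmult (w, dil N (exp (t * 0)) (- w)) (0, t *\<^sub>R grading (- w))) (at 0)"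
    by (intro has_vector_derivative_mult has_vector_derivative_const dil_exp_derivative)
  then show ?thesis
    using linear_cmul[OF linear_dmult, of "(w, - w)" t "(0, - grading w)"]
      linear_neg[OF bounded_linear.linear[OF bounded_linear_grading]]
    by (simp add: conj_velocity_def)
qed

text \<open>\<open>dil N a\<close> is an endomorphism that commutes with all dilations, so it
  carries the curve obtained from \<open>w\<close> to the one obtained from
  \<open>dil N a w\<close>.\<close>

lemma dil_conj_velocity: "dil N a (conj_velocity w) = conj_velocity (dil N a w)"
proof -
  have "((\<lambda>s. dil N a (w \<otimes> dil N (exp (1 * s)) (- w))) has_vector_derivative
      dil N a (1 *\<^sub>R conj_velocity w)) (at 0)"
    by (rule bounded_linear.has_vector_derivative[OF bounded_linear_dil conj_dil_derivative])
  moreover have "dil N a (w \<otimes> dil N (exp (1 * s)) (- w)) = dil N a w \<otimes> dil N (exp (1 * s)) (- dil N a w)" for s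
    by (simp add: dil_mult dil_dil mult.commute)
  ultimately show ?thesis
    using vector_derivative_unique_at[OF conj_dil_derivative[of "dil N a w" 1]] by simp
qed

text \<open>Second derivatives of the group law enter here: the differential is itself
  differentiated in its base point.\<close>

lemma dmult_differentiable: "\<exists>F. ((\<lambda>p. dmult p w) has_derivative F) (at p)"
proof -
  have "C_k (Suc (Suc 0)) (\<lambda>(x, y). x \<otimes> y)"
    using smooth_mult by (simp only: smooth_def)
  then have "(\<lambda>p. dmult p w) differentiable (at p)"
    unfolding dmult_def by (cases w) (simp del: split_paired_All)
  then show ?thesis by (simp add: differentiable_def)
qed

text \<open>Reduces the vector argument of \<open>dmult\<close> to basis vectors, because
  differentiability in the base point is known for one fixed vector at a time.\<close>

lemma conj_velocity_eq_sum:
  "conj_velocity w = (\<Sum>b\<in>Basis. (- grading w \<bullet> b) *\<^sub>R dmult (w, - w) (0, b))"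
proof -
  have "linear (\<lambda>v. dmult (w, - w) (0, v))"
    using linear_compose[OF _ linear_dmult, of "\<lambda>v. (0, v)"] by (simp add: o_def linear_iff)
  then have "(\<Sum>b\<in>Basis. (v \<bullet> b) *\<^sub>R dmult (w, - w) (0, b)) = dmult (w, - w) (0, v)" for v
    using linear_sum[of "\<lambda>v. dmult (w, - w) (0, v)" "\<lambda>b. (v \<bullet> b) *\<^sub>R b" Basis]
    by (simp add: euclidean_representation linear_cmul[of "\<lambda>v. dmult (w, - w) (0, v)"])
  from this[of "- grading w"] show ?thesis by (simp only: conj_velocity_def)
qed

text \<open>At 0 the coefficients \<open>- grading w \<bullet> b\<close> vanish, so the unknown
  derivatives \<open>G b\<close> drop out of the product rule.\<close>

lemma conj_velocity_differentiable:
  "\<exists>F. (conj_velocity has_derivative F) (at w) \<and> (w = 0 \<longrightarrow> F = (\<lambda>h. - grading h))"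
proof -
  have "\<forall>b. \<exists>G. ((\<lambda>p. dmult p (0, b)) has_derivative G) (at (w, - w))"
    using dmult_differentiable by blast
  then obtain G where G: "((\<lambda>p. dmult p (0, b)) has_derivative G b) (at (w, - w))" for b
    unfolding choice_iff by blast
  have diag: "((\<lambda>w. (w, - w)) has_derivative (\<lambda>h. (h, - h))) (at w)"
    by (auto intro!: derivative_eq_intros)
  have 1: "((\<lambda>w. dmult (w, - w) (0, b)) has_derivative (\<lambda>h. G b (h, - h))) (at w)" for b
    using has_derivative_compose[where g = "\<lambda>p. dmult p (0, b)", OF diag G] .
  have 2: "((\<lambda>w. - grading w \<bullet> b) has_derivative (\<lambda>h. - grading h \<bullet> b)) (at w)" for b
    by (intro has_derivative_inner_left has_derivative_minus bounded_linear_imp_has_derivative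
        bounded_linear_grading)
  define F where "F = (\<lambda>h. \<Sum>b\<in>Basis. (- grading w \<bullet> b) *\<^sub>R G b (h, - h)
      + (- grading h \<bullet> b) *\<^sub>R dmult (w, - w) (0, b))"
  have "((\<lambda>w. \<Sum>b\<in>Basis. (- grading w \<bullet> b) *\<^sub>R dmult (w, - w) (0, b)) has_derivative F) (at w)"
    unfolding F_def by (intro has_derivative_sum has_derivative_scaleR 1 2)
  then have "(conj_velocity has_derivative F) (at w)"
    by (simp add: conj_velocity_eq_sum[abs_def])
  moreover have "F = (\<lambda>h. - grading h)" if "w = 0"
  proof
    fix h
    have "grading 0 = 0"
      using linear_0[OF bounded_linear.linear[OF bounded_linear_grading]] .
    then have "F h = (\<Sum>b\<in>Basis. (- grading h \<bullet> b) *\<^sub>R b)"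
      using that by (simp add: F_def dmult_0)
    then show "F h = - grading h" by (simp only: euclidean_representation)
  qed
  ultimately show ?thesis by blast
qed

text \<open>All weights are at least 1, so the derivative at 0 is invertible and the range contains
  a ball around 0. Any \<open>v\<close> is dilated into that ball, and the range is invariant under
  dilations.\<close>

lemma surj_conj_velocity: "\<exists>w. conj_velocity w = v"
proof -
  \<comment> \<open>Inverse of \<open>- grading\<close>: each component is divided by minus its
    weight.\<close>
  define g where "g = (\<lambda>x. - (\<Sum>j=1..step N. (1 / real j) *\<^sub>R component j x))"
  have "linear g"
    unfolding g_def by (rule linear_compose_neg[OF linear_scaled_components])
  then have bg: "bounded_linear g" using linear_conv_bounded_linear by blast
  have "component j (g x) = - (1 / real j) *\<^sub>R component j x" for j x
    unfolding g_def by (simp only: linear_neg[OF linear_component] component_scaled_sum scaleR_minus_left)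
  then have "grading (g x) = (\<Sum>j=1..step N. - component j x)" for x
    unfolding grading_def by (intro sum.cong) auto
  then have inv: "(\<lambda>h. - grading h) \<circ> g = id"
    by (simp del: One_nat_def add: fun_eq_iff sum_negf sum_component)
  have "continuous_on UNIV conj_velocity"
    using conj_velocity_differentiable has_derivative_continuous
    by (metis continuous_at_imp_continuous_on)
  moreover have "(conj_velocity has_derivative (\<lambda>h. - grading h)) (at 0)"
    using conj_velocity_differentiable[of 0] by auto
  ultimately have "conj_velocity 0 \<in> interior (conj_velocity ` UNIV)"
    using sussmann_open_mapping[OF open_UNIV, of conj_velocity 0 "\<lambda>h. - grading h" g UNIV] bg inv
    by simp
  moreover have "conj_velocity 0 = 0"
    using linear_0[OF bounded_linear.linear[OF bounded_linear_grading]]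
      linear_0[OF linear_dmult] by (simp add: conj_velocity_def flip: zero_prod_def)
  ultimately obtain e where e: "0 < e" "ball 0 e \<subseteq> range conj_velocity"
    by (auto simp: mem_interior)
  obtain d where d: "d > 0" "\<And>a. dist a 0 < d \<Longrightarrow> dist (dil N a v) (dil N 0 v) < e"
    using continuous_dil[of UNIV v, unfolded continuous_on_iff, rule_format, of 0 e] e(1) by auto
  define a where "a = d / 2"
  have a: "dist (dil N a v) 0 < e" "0 < a"
    using d(2)[of a] d(1) by (simp_all add: a_def)
  then have "dil N a v \<in> range conj_velocity"
    using e(2) by (auto simp: dist_commute subset_iff)
  then obtain w where "dil N a v = conj_velocity w"
    by blast
  moreover have "dil N (1 / a) (dil N a v) = v"
    using a(2) by (simp add: dil_dil)
  ultimately have "conj_velocity (dil N (1 / a) w) = v"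
    by (simp add: dil_conj_velocity)
  then show ?thesis ..
qed

section \<open>The exponential map of the semidirect product\<close>

lemma semidirect_mult [simp]:
  "(n, a) \<otimes>\<^bsub>semidirect N\<^esub> (n', a') = (n \<otimes> dil N a n', a * a')"
  by (simp add: semidirect_def)

lemma carrier_semidirect: "carrier (semidirect N) = UNIV \<times> {0<..}"
  by (simp add: semidirect_def)

text \<open>Conjugating \<open>s \<mapsto> (0, exp (t * s))\<close> by \<open>(w, 1)\<close> yields
  a one-parameter group with the required velocity. Most of the proof serves \<open>THE\<close>: a
  homomorphism with that velocity at 0 is unique.\<close>

lemma lie_exp_semidirect:
  assumes w: "conj_velocity w = v"
  shows "lie_exp (semidirect N) (t *\<^sub>R (v, 1)) = (w \<otimes> dil N (exp t) (- w), exp t)"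
proof -
  define \<beta> where "\<beta> = (\<lambda>s. w \<otimes> dil N (exp (t * s)) (- w))"
  have \<beta>0: "\<beta> 0 = 0" by (simp add: \<beta>_def)
  have \<beta>': "(\<beta> has_vector_derivative t *\<^sub>R v) (at 0)"
    unfolding \<beta>_def using conj_dil_derivative w by blast
  let ?P = "\<lambda>\<gamma>. (\<forall>s. \<gamma> s \<in> carrier (semidirect N)) \<and>
      (\<forall>s s'. \<gamma> (s + s') = \<gamma> s \<otimes>\<^bsub>semidirect N\<^esub> \<gamma> s') \<and>
      (\<gamma> has_vector_derivative t *\<^sub>R (v, 1)) (at (0::real))"
  have "?P (\<lambda>s. (\<beta> s, exp (t * s)))"
  proof (intro conjI allI)
    show "((\<lambda>s. (\<beta> s, exp (t * s))) has_vector_derivative t *\<^sub>R (v, 1)) (at 0)"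
    proof -
      have "((\<lambda>s. exp (t * s)) has_vector_derivative t) (at 0)"
        by (auto intro!: derivative_eq_intros simp flip: has_real_derivative_iff_has_vector_derivative)
      from has_vector_derivative_Pair[OF \<beta>' this] show ?thesis by simp
    qed
    show "(\<beta> (s + s'), exp (t * (s + s'))) = (\<beta> s, exp (t * s)) \<otimes>\<^bsub>semidirect N\<^esub> (\<beta> s', exp (t * s'))" for s s'
      by (simp add: \<beta>_def dil_mult dil_dil mult_assoc distrib_left exp_add)
  qed (simp add: carrier_semidirect)
  moreover have "\<gamma> = (\<lambda>s. (\<beta> s, exp (t * s)))" if \<gamma>: "?P \<gamma>" for \<gamma>
  proof -
    define n where "n = (\<lambda>s. fst (\<gamma> s))"
    define \<alpha> where "\<alpha> = (\<lambda>s. snd (\<gamma> s))"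
    have \<gamma>_eq: "\<gamma> s = (n s, \<alpha> s)" for s by (simp add: n_def \<alpha>_def)
    have \<alpha>_pos: "\<alpha> s > 0" for s
      using \<gamma> by (auto simp: \<gamma>_eq carrier_semidirect)
    have \<alpha>_add: "\<alpha> (s + s') = \<alpha> s * \<alpha> s'" and n_add: "n (s + s') = n s \<otimes> dil N (\<alpha> s) (n s')" for s s'
      using \<gamma> by (simp_all add: \<gamma>_eq)
    have "(n has_vector_derivative t *\<^sub>R v) (at 0)"
      using bounded_linear.has_vector_derivative[OF bounded_linear_fst, of \<gamma>] \<gamma>
      by (auto simp: n_def)
    moreover have "((\<lambda>s. - \<beta> s) has_vector_derivative - (t *\<^sub>R v)) (at 0)"
      by (intro derivative_intros \<beta>')
    ultimately have n': "((\<lambda>s. n s \<otimes> - \<beta> s) has_vector_derivative dmult (n 0, - \<beta> 0) (t *\<^sub>R v, - (t *\<^sub>R v))) (at 0)"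
      by (rule has_vector_derivative_mult)
    have \<alpha>': "(\<alpha> has_real_derivative t) (at 0)"
      using bounded_linear.has_vector_derivative[OF bounded_linear_snd, of \<gamma>] \<gamma>
      by (auto simp: \<alpha>_def has_real_derivative_iff_has_vector_derivative)
    have "\<alpha> 0 * \<alpha> 0 = \<alpha> 0" using \<alpha>_add[of 0 0] by simp
    then have \<alpha>0: "\<alpha> 0 = 1" using \<alpha>_pos[of 0] by simp
    have "((\<lambda>h. \<alpha> h * exp (- t * h)) has_real_derivative 0) (at 0)"
      by (auto intro!: derivative_eq_intros \<alpha>' simp: \<alpha>0)
    from DERIV_cmult[OF this]
    have "((\<lambda>h. (\<alpha> s * exp (- t * s)) * (\<alpha> h * exp (- t * h))) has_vector_derivative 0) (at 0)" for s
      by (simp flip: has_real_derivative_iff_has_vector_derivative)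
    moreover have "(\<alpha> s * exp (- t * s)) * (\<alpha> h * exp (- t * h)) = \<alpha> (s + h) * exp (- t * (s + h))" for s h
      by (simp only: \<alpha>_add distrib_left exp_add mult_ac)
    ultimately have "((\<lambda>h. \<alpha> (s + h) * exp (- t * (s + h))) has_vector_derivative 0) (at 0)" for s
      by (simp only:)
    then have "\<alpha> s * exp (- t * s) = \<alpha> 0 * exp (- t * 0)" for s
      by (rule constant_if_shifted_derivative_zero)
    then have \<alpha>: "\<alpha> s = exp (t * s)" for s by (simp add: \<alpha>0 exp_minus field_simps)
    have "n 0 \<otimes> n 0 = n 0" using n_add[of 0 0] by (simp add: \<alpha>0)
    then have n0: "n 0 = 0" using l_cancel_one'[of "n 0" "n 0"] by (simp add: one_eq_0)
    \<comment> \<open>The \<open>N\<close>-part of \<open>\<gamma>\<close> after the conjugation by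
      \<open>w\<close> is undone; it has to vanish identically. Its derivative at 0 is 0 because
      \<open>n\<close> and \<open>\<beta>\<close> have the same velocity there.\<close>
    define m where "m = (\<lambda>s. - w \<otimes> n s \<otimes> dil N (\<alpha> s) w)"
    have "m = (\<lambda>s. Ad (- w) (n s \<otimes> - \<beta> s))"
      by (simp add: fun_eq_iff m_def Ad_def \<beta>_def \<alpha> minus_mult mult_assoc)
    then have "(m has_vector_derivative 0) (at 0)"
      using bounded_linear.has_vector_derivative[OF bounded_linear_Ad n', of "- w"]
      by (simp add: n0 \<beta>0 dmult_0)
    from bounded_linear.has_vector_derivative[OF bounded_linear_dil this]
    have "((\<lambda>h. m s \<otimes> dil N (\<alpha> s) (m h)) has_vector_derivative
        dmult (m s, dil N (\<alpha> s) (m 0)) (0, dil N (\<alpha> s) 0)) (at 0)" for s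
      by (intro has_vector_derivative_mult has_vector_derivative_const)
    moreover have "m s \<otimes> dil N (\<alpha> s) (m h) = m (s + h)" for s h
      by (simp add: m_def n_add \<alpha>_add dil_mult dil_dil mult_assoc)
    ultimately have "((\<lambda>h. m (s + h)) has_vector_derivative 0) (at 0)" for s
      using linear_0[OF linear_dmult] by (simp flip: zero_prod_def)
    then have "m s = m 0" for s by (rule constant_if_shifted_derivative_zero)
    then have m: "m s = 0" for s by (simp add: m_def n0 \<alpha>0)
    have "n s = \<beta> s" for s
    proof -
      have "w \<otimes> m s \<otimes> - dil N (\<alpha> s) w = n s" by (simp add: m_def mult_assoc)
      then show ?thesis by (simp add: m \<beta>_def \<alpha>)
    qed
    then show ?thesis by (simp add: fun_eq_iff \<gamma>_eq \<alpha>)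
  qed
  ultimately have "(THE \<gamma>. ?P \<gamma>) = (\<lambda>s. (\<beta> s, exp (t * s)))"
    by (rule the_equality)
  then show ?thesis by (simp add: lie_exp_def \<beta>_def)
qed

end

section \<open>Right translations preserve Lebesgue measure\<close>

text \<open>
  The change of variables theorem of the library is stated for \<^typ>\<open>real ^ 'n\<close>. Indexing
  coordinates by the basis vectors transfers it to every Euclidean space.
\<close>

typedef (overloaded) 'a basis_index = "Basis :: 'a::euclidean_space set"
  by (rule nonempty_Basis[unfolded ex_in_conv[symmetric]])

instance basis_index :: (euclidean_space) finite
proof
  have "inj (Rep_basis_index :: 'a basis_index \<Rightarrow> 'a)"
    by (simp add: inj_def Rep_basis_index_inject)
  moreover have "finite (range (Rep_basis_index :: 'a basis_index \<Rightarrow> 'a))"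
    using Rep_basis_index by (auto intro: finite_subset[OF _ finite_Basis])
  ultimately show "finite (UNIV :: 'a basis_index set)"
    by (rule finite_imageD[rotated])
qed

text \<open>The change of variables theorem asks for a well-ordered index type; the order is pulled
  back from an enumeration of the finite basis.\<close>

instantiation basis_index :: (euclidean_space) wellorder
begin

definition "i \<le> j \<longleftrightarrow> to_nat_on Basis (Rep_basis_index i) \<le> to_nat_on Basis (Rep_basis_index j)"

definition "i < j \<longleftrightarrow> to_nat_on Basis (Rep_basis_index i) < to_nat_on Basis (Rep_basis_index j)"

instance
proof
  fix i j k :: "'a basis_index"
  show "i < j \<longleftrightarrow> i \<le> j \<and> \<not> j \<le> i" "i \<le> i" "i \<le> j \<Longrightarrow> j \<le> k \<Longrightarrow> i \<le> k" "i \<le> j \<or> j \<le> i"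
    unfolding less_eq_basis_index_def less_basis_index_def by auto
  show "i = j" if "i \<le> j" "j \<le> i"
    using that inj_on_to_nat_on[of "Basis :: 'a set"] Rep_basis_index
    unfolding less_eq_basis_index_def
    by (metis Rep_basis_index_inject countable_finite finite_Basis inj_on_def le_antisym)
next
  fix P :: "'a basis_index \<Rightarrow> bool" and i
  assume "\<And>i. (\<And>j. j < i \<Longrightarrow> P j) \<Longrightarrow> P i"
  then show "P i"
    unfolding less_basis_index_def
    by (rule measure_induct_rule[where f = "\<lambda>i. to_nat_on Basis (Rep_basis_index i)"])
qed

end

lemma bij_Rep_basis_index: "bij_betw Rep_basis_index UNIV (Basis :: 'a::euclidean_space set)"
  by (metis Rep_basis_index_inject bij_betw_def inj_def
      type_definition.Rep_range type_definition_basis_index)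

lemma ball_Basis_iff: "(\<forall>b\<in>Basis. P b) \<longleftrightarrow> (\<forall>i. P (Rep_basis_index i))"
  using bij_betw_imp_surj_on[OF bij_Rep_basis_index] by (metis rangeE rangeI)

definition to_vec :: "'a::euclidean_space \<Rightarrow> real ^ 'a basis_index" where
  "to_vec x = (\<chi> i. x \<bullet> Rep_basis_index i)"

definition of_vec :: "real ^ 'a::euclidean_space basis_index \<Rightarrow> 'a" where
  "of_vec v = (\<Sum>i\<in>UNIV. v $ i *\<^sub>R Rep_basis_index i)"

lemma of_vec_to_vec [simp]: "of_vec (to_vec x) = x"
proof -
  have "of_vec (to_vec x) = (\<Sum>b\<in>Basis. (x \<bullet> b) *\<^sub>R b)"
    unfolding of_vec_def to_vec_def
    using sum.reindex_bij_betw[OF bij_Rep_basis_index, of "\<lambda>b. (x \<bullet> b) *\<^sub>R b"] by simp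
  then show ?thesis by (simp add: euclidean_representation)
qed

lemma of_vec_inner_Rep: "of_vec v \<bullet> Rep_basis_index i = v $ i"
proof -
  have "Rep_basis_index j \<bullet> Rep_basis_index i = (if j = i then 1 else 0)" for j
    using inner_Basis[OF Rep_basis_index[of j] Rep_basis_index[of i]]
    by (simp add: Rep_basis_index_inject)
  then show ?thesis
    by (simp add: of_vec_def inner_sum_left if_distrib[of "(*) _"] cong: if_cong)
qed

lemma to_vec_of_vec [simp]: "to_vec (of_vec v) = v"
  by (simp add: to_vec_def of_vec_inner_Rep vec_eq_iff)

lemma bounded_linear_to_vec: "bounded_linear to_vec"
  unfolding linear_conv_bounded_linear[symmetric]
  by (rule linearI) (auto simp: to_vec_def vec_eq_iff inner_add_left)

lemma bounded_linear_of_vec: "bounded_linear of_vec"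
  unfolding linear_conv_bounded_linear[symmetric]
  by (rule linearI) (auto simp: of_vec_def scaleR_add_left sum.distrib scaleR_sum_right)

lemmas linear_to_vec = bounded_linear.linear[OF bounded_linear_to_vec]
lemmas linear_of_vec = bounded_linear.linear[OF bounded_linear_of_vec]

lemma measurable_of_vec [measurable]: "of_vec \<in> borel \<rightarrow>\<^sub>M borel"
  by (intro borel_measurable_continuous_onI linear_continuous_on bounded_linear_of_vec)

text \<open>\<open>of_vec\<close> carries boxes to boxes with the same side lengths, and
  \<open>lborel\<close> is determined by its values on boxes.\<close>

lemma lborel_eq_distr_of_vec: "lborel = distr lborel borel of_vec"
proof (rule lborel_eqI)
  fix l u :: 'a
  assume le: "\<And>b. b \<in> Basis \<Longrightarrow> l \<bullet> b \<le> u \<bullet> b"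
  have "of_vec -` box l u = box (to_vec l) (to_vec u)"
    unfolding box_def[of l u] ball_Basis_iff
    by (simp add: set_eq_iff mem_box_cart to_vec_def of_vec_inner_Rep)
  then have "emeasure (distr lborel borel of_vec) (box l u) = emeasure lborel (box (to_vec l) (to_vec u))"
    by (simp add: emeasure_distr)
  also have "\<dots> = (\<Prod>b\<in>Basis. (to_vec u - to_vec l) \<bullet> b)"
    using le[OF Rep_basis_index] by (intro emeasure_lborel_box) (auto simp: Basis_vec_def inner_axis to_vec_def)
  also have "(\<Prod>b\<in>Basis. (to_vec u - to_vec l) \<bullet> b) = (\<Prod>i\<in>UNIV. (to_vec u - to_vec l) $ i)"
  proof -
    have "Basis = (\<lambda>i. axis i (1::real)) ` (UNIV :: 'a basis_index set)"
      by (auto simp: Basis_vec_def)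
    moreover have "inj (\<lambda>i. axis i (1::real) :: real ^ 'a basis_index)"
      by (auto simp: inj_def axis_eq_axis)
    ultimately have "(\<Prod>b\<in>Basis. (to_vec u - to_vec l) \<bullet> b) = (\<Prod>i\<in>UNIV. (to_vec u - to_vec l) \<bullet> axis i 1)"
      using prod.reindex by fastforce
    then show ?thesis by (simp add: inner_axis)
  qed
  also have "\<dots> = (\<Prod>b\<in>Basis. (u - l) \<bullet> b)"
    using prod.reindex_bij_betw[OF bij_Rep_basis_index, of "\<lambda>b. (u - l) \<bullet> b"]
    by (simp add: to_vec_def inner_diff_left)
  finally show "emeasure (distr lborel borel of_vec) (box l u) = (\<Prod>b\<in>Basis. (u - l) \<bullet> b)" .
qed simp

section \<open>Determinants and volume-preserving maps\<close>

definition coord_det :: "('a::euclidean_space \<Rightarrow> 'a) \<Rightarrow> real" where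
  "coord_det T = det (matrix (to_vec \<circ> T \<circ> of_vec))"

lemma coord_det_compose:
  assumes "linear S" "linear T"
  shows "coord_det (S \<circ> T) = coord_det S * coord_det T"
proof -
  have lin: "linear (to_vec \<circ> R \<circ> of_vec)" if "linear R" for R :: "'a \<Rightarrow> 'a"
    by (rule linear_compose[OF linear_of_vec linear_compose[OF that linear_to_vec]])
  have "to_vec \<circ> (S \<circ> T) \<circ> of_vec = (to_vec \<circ> S \<circ> of_vec) \<circ> (to_vec \<circ> T \<circ> of_vec)"
    by (simp add: fun_eq_iff)
  then show ?thesis
    unfolding coord_det_def
    by (simp only: matrix_compose[OF lin[OF assms(2)] lin[OF assms(1)]] det_mul)
qed

lemma coord_det_id: "coord_det (\<lambda>x. x) = 1"
proof -
  have "to_vec \<circ> (\<lambda>x::'a. x) \<circ> of_vec = id" by (simp add: fun_eq_iff)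
  then show ?thesis by (simp add: coord_det_def matrix_id_mat_1)
qed

lemma coord_det_eq:
  "coord_det T = det (\<chi> i j. T (Rep_basis_index j) \<bullet> Rep_basis_index i)"
proof -
  have "of_vec (axis j 1) = Rep_basis_index j" for j :: "'a basis_index"
    by (simp add: of_vec_def axis_def if_distrib[of "\<lambda>c. c *\<^sub>R _"] cong: if_cong)
  then show ?thesis
    by (simp add: coord_det_def matrix_def to_vec_def)
qed

lemma continuous_on_coord_det:
  assumes "\<And>b. continuous_on S (\<lambda>p. T p b)"
  shows "continuous_on S (\<lambda>p. coord_det (T p))"
  unfolding coord_det_eq det_def
  by (simp, intro continuous_intros assms)

text \<open>The theorem on differentiable images only bounds the measure of an image from above.
  Applied to \<open>f\<close> and to its inverse \<open>g\<close>, it gives both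
  inequalities.\<close>

lemma distr_lborel_eq_if_det_1:
  fixes f g :: "'a::euclidean_space \<Rightarrow> 'a"
  assumes f: "\<And>x. (f has_derivative f' x) (at x)" "\<And>x. \<bar>coord_det (f' x)\<bar> = 1"
    and g: "\<And>x. (g has_derivative g' x) (at x)" "\<And>x. \<bar>coord_det (g' x)\<bar> = 1"
    and inv: "\<And>x. f (g x) = x" "\<And>x. g (f x) = x"
  shows "distr lborel borel f = lborel"
proof -
  have image: "h ` S \<in> lmeasurable \<and> measure lebesgue (h ` S) \<le> measure lebesgue S"
    if h: "h = to_vec \<circ> k \<circ> of_vec" "\<And>x. (k has_derivative k' x) (at x)" "\<And>x. \<bar>coord_det (k' x)\<bar> = 1"
      and S: "S \<in> lmeasurable" for h k k' S
  proof -
    have "(h has_derivative to_vec \<circ> k' (of_vec x) \<circ> of_vec) (at x within S)" for x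
    proof -
      have 1: "(of_vec has_derivative of_vec) (at x within S)"
        by (rule bounded_linear_imp_has_derivative[OF bounded_linear_of_vec])
      have "((\<lambda>x. to_vec (k (of_vec x))) has_derivative (\<lambda>y. to_vec (k' (of_vec x) (of_vec y)))) (at x within S)"
        by (rule bounded_linear.has_derivative[OF bounded_linear_to_vec has_derivative_compose[OF 1 h(2)]])
      then show ?thesis by (simp add: h(1) o_def)
    qed
    note deriv = this
    have det: "\<bar>det (matrix (to_vec \<circ> k' (of_vec x) \<circ> of_vec))\<bar> = 1" for x
      using h(3) by (simp only: coord_det_def)
    have int: "(\<lambda>x. \<bar>det (matrix (to_vec \<circ> k' (of_vec x) \<circ> of_vec))\<bar>) integrable_on S"
      unfolding det using S by (simp add: lmeasurable_iff_integrable_on)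
    show ?thesis
      using measurable_bounded_differentiable_image[OF S deriv int, of 1]
        measure_bounded_differentiable_image[OF S deriv int, of 1] by (simp add: det)
  qed
  define F where "F = to_vec \<circ> f \<circ> of_vec"
  define G where "G = to_vec \<circ> g \<circ> of_vec"
  have FG: "F (G v) = v" "G (F v) = v" for v by (simp_all add: F_def G_def inv)
  have contf: "continuous_on S f" for S
    by (rule continuous_at_imp_continuous_on) (use has_derivative_continuous[OF f(1)] in blast)
  have contF: "continuous_on UNIV F"
    unfolding F_def
    by (intro continuous_on_compose linear_continuous_on bounded_linear_to_vec
        bounded_linear_of_vec contf)
  then have measF [measurable]: "F \<in> borel \<rightarrow>\<^sub>M borel"
    by (rule borel_measurable_continuous_onI)
  have "lborel = distr lborel borel F"
  proof (rule lborel_eqI)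
    fix l u :: "real ^ 'a basis_index"
    assume le: "\<And>b. b \<in> Basis \<Longrightarrow> l \<bullet> b \<le> u \<bullet> b"
    have vim: "F -` box l u = G ` box l u"
      using FG(1) by (auto simp: image_iff) (metis FG(2))
    have G: "G ` box l u \<in> lmeasurable" "measure lebesgue (G ` box l u) \<le> measure lebesgue (box l u)"
      using image[OF G_def g lmeasurable_box] by (rule conjunct1, rule conjunct2)
    have "F ` G ` box l u = box l u" by (simp only: image_image FG image_ident)
    then have "measure lebesgue (box l u) = measure lebesgue (G ` box l u)"
      using image[OF F_def f G(1)] G(2) by simp
    then have "emeasure lebesgue (G ` box l u) = emeasure lebesgue (box l u)"
      by (simp only: emeasure_eq_measure2[OF G(1)] emeasure_eq_measure2[OF lmeasurable_box])
    moreover have "open (F -` box l u)"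
      by (rule open_vimage[OF open_box contF])
    then have "emeasure lborel (F -` box l u) = emeasure lebesgue (F -` box l u)"
      by simp
    ultimately have "emeasure lborel (F -` box l u) = emeasure lborel (box l u)"
      by (simp add: vim)
    then show "emeasure (distr lborel borel F) (box l u) = (\<Prod>b\<in>Basis. (u - l) \<bullet> b)"
      using le by (simp add: emeasure_distr)
  qed simp
  then have "distr lborel borel of_vec = distr (distr lborel borel F) borel of_vec"
    by simp
  also have "\<dots> = distr lborel borel (of_vec \<circ> F)"
    by (subst distr_distr) auto
  also have "of_vec \<circ> F = f \<circ> of_vec" by (simp add: F_def fun_eq_iff)
  also have "distr lborel borel (f \<circ> of_vec) = distr (distr lborel borel of_vec) borel f"
  proof -
    have "f \<in> borel \<rightarrow>\<^sub>M borel"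
      by (rule borel_measurable_continuous_onI[OF contf])
    then show ?thesis by (subst distr_distr) auto
  qed
  finally show ?thesis by (simp flip: lborel_eq_distr_of_vec)
qed

context stratified_group
begin

lemma right_mult_has_derivative:
  "((\<lambda>x. x \<otimes> y) has_derivative (\<lambda>u. dmult (x, y) (u, 0))) (at x)"
  by (rule has_derivative_mult[OF has_derivative_ident has_derivative_const])

text \<open>
  Dilations conjugate the right translation by \<open>y\<close> into the one by \<open>dil N a y\<close> without changing
  its Jacobian determinant, and the latter tends to \<open>1\<close> as \<open>a\<close> tends to \<open>0\<close>.
\<close>

lemma coord_det_right_mult: "coord_det (\<lambda>u. dmult (x, y) (u, 0)) = 1"
proof -
  define \<Delta> where "\<Delta> = (\<lambda>a. coord_det (\<lambda>u. dmult (dil N a x, dil N a y) (u, 0)))"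
  have lin: "linear (\<lambda>u. dmult p (u, 0))" for p
    using linear_compose[OF _ linear_dmult, of "\<lambda>u. (u, 0)"] by (simp add: o_def linear_iff)
  have const: "\<Delta> a = \<Delta> 1" if "a > 0" for a
  proof -
    let ?T = "\<lambda>u. dmult (x, y) (u, 0)"
    let ?T' = "\<lambda>u. dmult (dil N a x, dil N a y) (u, 0)"
    have "((\<lambda>z. dil N a (z \<otimes> y)) has_derivative (\<lambda>u. dil N a (?T u))) (at x)"
      by (rule bounded_linear.has_derivative[OF bounded_linear_dil right_mult_has_derivative])
    moreover have "((\<lambda>z. dil N a z \<otimes> dil N a y) has_derivative (\<lambda>u. ?T' (dil N a u))) (at x)"
      by (rule has_derivative_mult[OF bounded_linear_imp_has_derivative[OF bounded_linear_dil] has_derivative_const])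
    ultimately have "(\<lambda>u. dil N a (?T u)) = (\<lambda>u. ?T' (dil N a u))"
      by (simp only: dil_mult has_derivative_unique)
    then have "coord_det (dil N a \<circ> ?T) = coord_det (?T' \<circ> dil N a)"
      by (simp add: o_def)
    then have "coord_det (dil N a) * coord_det ?T = coord_det ?T' * coord_det (dil N a)"
      by (simp only: coord_det_compose[OF linear_dil lin] coord_det_compose[OF lin linear_dil])
    moreover have "coord_det (dil N (1 / a)) * coord_det (dil N a) = 1"
    proof -
      have "dil N (1 / a) \<circ> dil N a = (\<lambda>x. x)" using that by (simp add: fun_eq_iff dil_dil)
      then show ?thesis by (simp flip: coord_det_compose[OF linear_dil linear_dil] add: coord_det_id)
    qed
    ultimately show ?thesis by (auto simp: \<Delta>_def)
  qed
  \<comment> \<open>Continuity matters at \<open>a = 0\<close>, where both factors collapse to the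
    identity and the differential of the product is plain addition.\<close>
  have "continuous_on UNIV \<Delta>"
    unfolding \<Delta>_def
    by (intro continuous_on_coord_det continuous_on_compose2[OF continuous_on_dmult])
      (auto intro!: continuous_intros continuous_dil)
  then have "(\<Delta> \<longlongrightarrow> \<Delta> 0) (at_right 0)"
    by (simp add: continuous_on_def tendsto_within_subset[of _ _ _ UNIV])
  moreover have "\<Delta> 0 = 1" by (simp add: \<Delta>_def dmult_0 coord_det_id)
  ultimately have "(\<Delta> \<longlongrightarrow> 1) (at_right 0)" by simp
  then have "((\<lambda>_. \<Delta> 1) \<longlongrightarrow> 1) (at_right (0::real))"
    by (rule Lim_transform_eventually)
      (auto simp: eventually_at_filter intro!: always_eventually intro: const)
  then have "\<Delta> 1 = 1" by (simp add: tendsto_const_iff)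
  then show ?thesis by (simp add: \<Delta>_def)
qed

lemma distr_lborel_right_mult: "distr lborel borel (\<lambda>x. x \<otimes> y) = lborel"
proof (rule distr_lborel_eq_if_det_1)
  show "((\<lambda>x. x \<otimes> y) has_derivative (\<lambda>u. dmult (x, y) (u, 0))) (at x)"
    "((\<lambda>x. x \<otimes> - y) has_derivative (\<lambda>u. dmult (x, - y) (u, 0))) (at x)" for x
    by (rule right_mult_has_derivative)+
qed (simp_all add: coord_det_right_mult)

end

section \<open>The measure of flow tubes\<close>

lemma sets_right_haar: "sets (right_haar :: ('a::euclidean_space \<times> real) measure)
    = sets (restrict_space borel (UNIV \<times> {0<..}))"
  unfolding right_haar_def sets_density by (rule sets_restrict_space_cong) simp

lemma open_half_space: "open (UNIV \<times> {0::real<..})"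
  by (intro open_Times) auto

lemma open_in_sets_right_haar:
  "open T \<Longrightarrow> T \<subseteq> UNIV \<times> {0<..} \<Longrightarrow> T \<in> sets right_haar"
  by (auto simp: sets_right_haar sets_restrict_space_iff open_half_space)

text \<open>Tonelli with the \<open>N\<close>-integral inside: at a fixed height \<open>a\<close>
  the flow acts on \<open>N\<close> by a single right translation, so slices are evaluated
  first.\<close>

lemma nn_integral_right_haar:
  fixes g :: "'a::euclidean_space \<times> real \<Rightarrow> ennreal"
  assumes g: "g \<in> borel_measurable right_haar"
  shows "integral\<^sup>N right_haar g =
    (\<integral>\<^sup>+a. (\<integral>\<^sup>+n. ennreal (1 / a) * g (n, a) * indicator {0<..} a \<partial>lborel) \<partial>lborel)"
proof -
  let ?C = "UNIV \<times> {0<..} :: ('a \<times> real) set"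
  let ?R = "restrict_space lborel ?C"
  have C: "?C \<inter> space lborel \<in> sets lborel"
    by (simp add: open_half_space borel_open)
  have g': "g \<in> borel_measurable ?R"
    using g unfolding right_haar_def by simp
  have d: "(\<lambda>(n, a). ennreal (1 / a)) \<in> borel_measurable ?R"
  proof (intro measurable_restrict_space1)
    have [measurable]: "(snd :: 'a \<times> real \<Rightarrow> real) \<in> borel \<rightarrow>\<^sub>M borel"
      by (intro borel_measurable_continuous_onI continuous_intros)
    have "(\<lambda>p :: 'a \<times> real. ennreal (1 / snd p)) \<in> borel_measurable borel" by measurable
    then show "(\<lambda>(n :: 'a, a). ennreal (1 / a)) \<in> borel_measurable lborel"
      by (simp add: case_prod_unfold)
  qed
  have h: "(\<lambda>x. (case x of (n, a) \<Rightarrow> ennreal (1 / a)) * g x * indicator ?C x) \<in> borel_measurable lborel"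
    by (rule iffD1[OF borel_measurable_restrict_space_iff_ennreal[OF C] borel_measurable_times_ennreal[OF d g']])
  have "integral\<^sup>N right_haar g = (\<integral>\<^sup>+x. (case x of (n, a) \<Rightarrow> ennreal (1 / a)) * g x \<partial>?R)"
    unfolding right_haar_def by (rule nn_integral_density[OF d g'])
  also have "\<dots> = (\<integral>\<^sup>+x. (case x of (n, a) \<Rightarrow> ennreal (1 / a)) * g x * indicator ?C x \<partial>lborel)"
    by (rule nn_integral_restrict_space[OF C])
  also have "\<dots> = (\<integral>\<^sup>+x. (case x of (n, a) \<Rightarrow> ennreal (1 / a)) * g x * indicator ?C x \<partial>(lborel \<Otimes>\<^sub>M lborel))"
    by (simp add: lborel_prod)
  also have "\<dots> = (\<integral>\<^sup>+a. (\<integral>\<^sup>+n. ennreal (1 / a) * g (n, a) * indicator ?C (n, a) \<partial>lborel) \<partial>lborel)"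
    using h by (subst lborel_pair.nn_integral_snd[symmetric]) (simp_all add: lborel_prod)
  finally show ?thesis by (simp add: indicator_def)
qed

text \<open>The primitive of \<open>1 / a\<close> is \<open>ln\<close>. The closed interval required
  by the fundamental theorem differs from the given set by its endpoints only.\<close>

lemma nn_integral_inverse_interval:
  assumes "s \<le> t"
  shows "(\<integral>\<^sup>+a. ennreal (1 / a) * indicator {a. 0 < a \<and> s < ln a \<and> ln a < t} a \<partial>lborel) = ennreal (t - s)"
proof -
  have "AE a in lborel. a \<noteq> exp s \<and> a \<noteq> exp t"
    using AE_lborel_singleton[of "exp s"] AE_lborel_singleton[of "exp t"] by eventually_elim auto
  then have "AE a in lborel. ennreal (1 / a) * indicator {a. 0 < a \<and> s < ln a \<and> ln a < t} a
      = ennreal (1 / a) * indicator {exp s..exp t} a"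
  proof eventually_elim
    case (elim a)
    have "(0 < a \<and> s < ln a \<and> ln a < t) \<longleftrightarrow> exp s \<le> a \<and> a \<le> exp t"
    proof
      assume "0 < a \<and> s < ln a \<and> ln a < t"
      then show "exp s \<le> a \<and> a \<le> exp t" by (metis exp_ln less_imp_le exp_le_cancel_iff)
    next
      assume a: "exp s \<le> a \<and> a \<le> exp t"
      then have "0 < a" using less_le_trans[OF exp_gt_zero] by blast
      moreover have "exp s < exp (ln a)" "exp (ln a) < exp t"
        using a elim \<open>0 < a\<close> by auto
      ultimately show "0 < a \<and> s < ln a \<and> ln a < t" by (simp only: exp_less_cancel_iff)
    qed
    then show ?case by (simp add: indicator_def)
  qed
  then have "(\<integral>\<^sup>+a. ennreal (1 / a) * indicator {a. 0 < a \<and> s < ln a \<and> ln a < t} a \<partial>lborel)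
      = (\<integral>\<^sup>+a. ennreal (1 / a) * indicator {exp s..exp t} a \<partial>lborel)"
    by (rule nn_integral_cong_AE)
  also have "\<dots> = ennreal (ln (exp t) - ln (exp s))"
  proof (rule nn_integral_FTC_Icc)
    fix x assume "x \<in> {exp s..exp t}"
    then have x: "0 < x" using less_le_trans[OF exp_gt_zero] by auto
    show "(ln has_real_derivative 1 / x) (at x)" by (rule DERIV_ln_divide[OF x])
    show "0 \<le> 1 / x" using x by simp
  qed (use assms in auto)
  finally show ?thesis by simp
qed

section \<open>Flow coordinates and tubes\<close>

lemma \<Z>_snd: "Z \<in> \<Z> N \<Longrightarrow> snd Z = 1"
  by (simp add: \<Z>_def scalar_prod_def X0_def real_vector.representation_zero)

text \<open>A cylinder over an arbitrary set of flow times; intervals given by their endpoints are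
  easier to dilate than the parameters \<open>r\<close> and \<open>a\<close>.\<close>

definition tube :: "'a::euclidean_space stratified \<Rightarrow> 'a \<times> real \<Rightarrow> 'a set \<Rightarrow> real set \<Rightarrow> ('a \<times> real) set" where
  "tube N Z E I =
     {(n, 1) \<otimes>\<^bsub>semidirect N\<^esub> lie_exp (semidirect N) (t *\<^sub>R Z) | n t. n \<in> E \<and> t \<in> I}"

lemma cylinder_eq_tube: "cylinder N Z r E a = tube N Z E {ln (a / r)<..<ln (a * r)}"
  by (simp add: cylinder_def tube_def)

context stratified_group
begin

definition flow_curve :: "'a \<Rightarrow> real \<Rightarrow> 'a" where
  "flow_curve w t = w \<otimes> dil N (exp t) (- w)"

lemma lie_exp_flow_curve:
  assumes "Z \<in> \<Z> N"
  obtains w where "\<And>t. lie_exp (semidirect N) (t *\<^sub>R Z) = (flow_curve w t, exp t)"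
proof -
  obtain w where "conj_velocity w = fst Z" using surj_conj_velocity by blast
  from lie_exp_semidirect[OF this] \<Z>_snd[OF assms]
  have "lie_exp (semidirect N) (t *\<^sub>R Z) = (flow_curve w t, exp t)" for t
    by (metis flow_curve_def prod.collapse)
  then show ?thesis using that by blast
qed

lemma continuous_on_flow_curve:
  "continuous_on S f \<Longrightarrow> continuous_on S (\<lambda>x. flow_curve w (f x))"
  unfolding flow_curve_def
  by (intro continuous_intros continuous_on_compose2[OF continuous_dil[of UNIV]]) auto

context
  fixes Z w
  assumes lie_exp_Z: "\<And>t. lie_exp (semidirect N) (t *\<^sub>R Z) = (flow_curve w t, exp t)"
begin

lemma flow_point: "(n, 1) \<otimes>\<^bsub>semidirect N\<^esub> lie_exp (semidirect N) (t *\<^sub>R Z) = (n \<otimes> flow_curve w t, exp t)"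
  by (simp add: lie_exp_Z)

text \<open>Inverts the flow coordinates: the \<open>A\<close>-component gives the time, and a right
  translation then recovers the starting point in \<open>N\<close>.\<close>

lemma mem_tube_iff: "(x, a) \<in> tube N Z E I \<longleftrightarrow> 0 < a \<and> ln a \<in> I \<and> x \<otimes> - flow_curve w (ln a) \<in> E"
proof -
  have "(x, a) \<in> tube N Z E I \<longleftrightarrow> (\<exists>n t. x = n \<otimes> flow_curve w t \<and> a = exp t \<and> n \<in> E \<and> t \<in> I)"
    unfolding tube_def flow_point by blast
  also have "\<dots> \<longleftrightarrow> 0 < a \<and> ln a \<in> I \<and> x \<otimes> - flow_curve w (ln a) \<in> E"
    by (auto intro!: exI[of _ "x \<otimes> - flow_curve w (ln a)"] exI[of _ "ln a"])
  finally show ?thesis .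
qed

lemma open_tube_of_flow_curve:
  assumes "open E" "open I"
  shows "open (tube N Z E I)"
proof -
  let ?C = "UNIV \<times> {0<..} :: ('a \<times> real) set"
  let ?h = "\<lambda>p. (fst p \<otimes> - flow_curve w (ln (snd p)), ln (snd p))"
  have "continuous_on ?C ?h"
    by (intro continuous_intros continuous_on_flow_curve) auto
  moreover have "tube N Z E I = ?C \<inter> ?h -` (E \<times> I)"
    by (auto simp: mem_tube_iff)
  ultimately show ?thesis
    using continuous_open_preimage[of ?C ?h "E \<times> I"] assms open_half_space by (simp add: open_Times)
qed

text \<open>Invariance of \<open>\<phi>\<close> pulls the density at height \<open>a\<close> back to
  height 1 along the flow. The starting point is a right translate of \<open>n\<close>, so the
  substitution preserves \<open>lborel\<close>.\<close>

lemma nn_integral_flow_slice: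
  assumes \<phi>: "flow_measure N Z \<phi> \<mu>" and E: "E \<in> sets borel" and a: "0 < a"
  shows "(\<integral>\<^sup>+n. ennreal (\<phi> (n, a)) * indicator E (n \<otimes> - flow_curve w (ln a)) \<partial>lborel)
     = emeasure (\<mu>\<^sub>N \<phi>) E"
proof -
  let ?R = "\<lambda>n. n \<otimes> - flow_curve w (ln a)"
  have \<phi>_eq: "\<phi> (n, a) = \<phi> (?R n, 1)" for n
  proof -
    have "\<phi> (?R n, 1) = \<phi> ((?R n, 1) \<otimes>\<^bsub>semidirect N\<^esub> lie_exp (semidirect N) (ln a *\<^sub>R Z))"
      using \<phi> by (auto simp: flow_measure_def carrier_semidirect)
    then show ?thesis using a by (simp add: flow_point)
  qed
  have meas: "(\<lambda>n. ennreal (\<phi> (n, 1))) \<in> borel_measurable borel"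
  proof -
    have 1: "\<phi> \<in> borel_measurable (restrict_space borel (UNIV \<times> {0<..}))"
      using \<phi> measurable_cong_sets[OF sets_right_haar refl] by (auto simp: flow_measure_def)
    have "(\<lambda>n. (n, 1)) \<in> borel \<rightarrow>\<^sub>M restrict_space borel (UNIV \<times> {0::real<..})"
      by (intro measurable_restrict_space2 borel_measurable_continuous_onI continuous_intros) auto
    from measurable_compose[OF this 1] show ?thesis by simp
  qed
  have R: "?R \<in> borel \<rightarrow>\<^sub>M borel"
    by (intro borel_measurable_continuous_onI continuous_intros)
  have "emeasure (\<mu>\<^sub>N \<phi>) E = (\<integral>\<^sup>+n. ennreal (\<phi> (n, 1)) * indicator E n \<partial>lborel)"
    unfolding \<mu>\<^sub>N_def using meas E by (intro emeasure_density) auto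
  also have "\<dots> = (\<integral>\<^sup>+n. ennreal (\<phi> (n, 1)) * indicator E n \<partial>(distr lborel borel ?R))"
    by (simp add: distr_lborel_right_mult)
  also have "\<dots> = (\<integral>\<^sup>+n. ennreal (\<phi> (?R n, 1)) * indicator E (?R n) \<partial>lborel)"
    using R meas E by (intro nn_integral_distr) auto
  finally show ?thesis by (simp add: \<phi>_eq)
qed

lemma emeasure_tube_of_flow_curve:
  assumes \<phi>: "flow_measure N Z \<phi> \<mu>" and E: "open E" and st: "s \<le> t"
  shows "emeasure \<mu> (tube N Z E {s<..<t}) = emeasure (\<mu>\<^sub>N \<phi>) E * ennreal (t - s)"
proof -
  let ?T = "tube N Z E {s<..<t}"
  let ?I = "{a. 0 < a \<and> s < ln a \<and> ln a < t}"
  have \<phi>_meas: "\<phi> \<in> borel_measurable right_haar" and \<mu>: "\<mu> = density right_haar (\<lambda>x. ennreal (\<phi> x))"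
    using \<phi> by (auto simp: flow_measure_def)
  have "?T \<subseteq> UNIV \<times> {0<..}" by (auto simp: mem_tube_iff)
  then have T: "?T \<in> sets right_haar"
    using E by (intro open_in_sets_right_haar open_tube_of_flow_curve) auto
  have ind: "indicator ?T (n, a) * indicator {0<..} a = (indicator E (n \<otimes> - flow_curve w (ln a)) * indicator ?I a :: ennreal)" for n a
    by (auto simp: indicator_def mem_tube_iff)
  have "emeasure \<mu> ?T = (\<integral>\<^sup>+x. ennreal (\<phi> x) * indicator ?T x \<partial>right_haar)"
    unfolding \<mu> using \<phi>_meas T by (intro emeasure_density) auto
  also have "\<dots> = (\<integral>\<^sup>+a. (\<integral>\<^sup>+n. ennreal (1 / a) * (ennreal (\<phi> (n, a)) * indicator ?T (n, a)) * indicator {0<..} a \<partial>lborel) \<partial>lborel)"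
    using \<phi>_meas T by (intro nn_integral_right_haar borel_measurable_times) auto
  also have "\<dots> = (\<integral>\<^sup>+a. emeasure (\<mu>\<^sub>N \<phi>) E * (ennreal (1 / a) * indicator ?I a) \<partial>lborel)"
  proof (intro nn_integral_cong)
    fix a :: real
    show "(\<integral>\<^sup>+n. ennreal (1 / a) * (ennreal (\<phi> (n, a)) * indicator ?T (n, a)) * indicator {0<..} a \<partial>lborel)
        = emeasure (\<mu>\<^sub>N \<phi>) E * (ennreal (1 / a) * indicator ?I a)"
    proof (cases "a \<in> ?I")
      case True
      have "(\<integral>\<^sup>+n. ennreal (1 / a) * (ennreal (\<phi> (n, a)) * indicator ?T (n, a)) * indicator {0<..} a \<partial>lborel)
          = (\<integral>\<^sup>+n. ennreal (1 / a) * (ennreal (\<phi> (n, a)) * indicator E (n \<otimes> - flow_curve w (ln a))) \<partial>lborel)"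
        using True ind[of _ a] by (intro nn_integral_cong) (simp add: mult.assoc)
      also have "\<dots> = ennreal (1 / a) * (\<integral>\<^sup>+n. ennreal (\<phi> (n, a)) * indicator E (n \<otimes> - flow_curve w (ln a)) \<partial>lborel)"
      proof (rule nn_integral_cmult)
        have 1: "\<phi> \<in> borel_measurable (restrict_space borel (UNIV \<times> {0<..}))"
          using \<phi>_meas measurable_cong_sets[OF sets_right_haar refl] by auto
        have "(\<lambda>n. (n, a)) \<in> borel \<rightarrow>\<^sub>M restrict_space borel (UNIV \<times> {0::real<..})"
          using True
          by (intro measurable_restrict_space2 borel_measurable_continuous_onI continuous_intros) auto
        from measurable_compose[OF this 1]
        have [measurable]: "(\<lambda>n. \<phi> (n, a)) \<in> borel_measurable borel" .
        have [measurable]: "(\<lambda>n. n \<otimes> - flow_curve w (ln a)) \<in> borel \<rightarrow>\<^sub>M borel"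
          by (intro borel_measurable_continuous_onI continuous_intros)
        have [measurable]: "E \<in> sets borel" using E by simp
        show "(\<lambda>n. ennreal (\<phi> (n, a)) * indicator E (n \<otimes> - flow_curve w (ln a))) \<in> borel_measurable lborel"
          by measurable
      qed
      also have "\<dots> = emeasure (\<mu>\<^sub>N \<phi>) E * (ennreal (1 / a) * indicator ?I a)"
        using True E by (simp add: nn_integral_flow_slice[OF \<phi>] mult.commute)
      finally show ?thesis .
    next
      case False
      then have "ennreal (1 / a) * (ennreal (\<phi> (n, a)) * indicator ?T (n, a)) * indicator {0<..} a = 0" for n
        by (simp only: mult.assoc ind) simp
      note eq = this
      show ?thesis unfolding eq using False by simp
    qed
  qed
  also have "\<dots> = emeasure (\<mu>\<^sub>N \<phi>) E * (\<integral>\<^sup>+a. ennreal (1 / a) * indicator ?I a \<partial>lborel)"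
    by (rule nn_integral_cmult) measurable
  also have "\<dots> = emeasure (\<mu>\<^sub>N \<phi>) E * ennreal (t - s)"
    by (simp only: nn_integral_inverse_interval[OF st])
  finally show ?thesis .
qed

lemma tube_meet_of_flow_curve:
  assumes "tube N Z E I \<inter> tube N Z E' I' \<noteq> {}"
  shows "E \<inter> E' \<noteq> {}" "I \<inter> I' \<noteq> {}"
  using assms by (auto simp: mem_tube_iff)

end

text \<open>Removes the conjugating element \<open>w\<close>, which exists for every
  \<open>Z\<close> in \<open>\<Z> N\<close>, from the facts on tubes.\<close>

lemma
  assumes Z: "Z \<in> \<Z> N"
  shows open_tube: "open E \<Longrightarrow> open I \<Longrightarrow> open (tube N Z E I)"
    and tube_subset_carrier: "tube N Z E I \<subseteq> carrier (semidirect N)"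
    and tube_meet: "tube N Z E I \<inter> tube N Z E' I' \<noteq> {} \<Longrightarrow> E \<inter> E' \<noteq> {} \<and> I \<inter> I' \<noteq> {}"
    and emeasure_tube: "flow_measure N Z \<phi> \<mu> \<Longrightarrow> open E \<Longrightarrow> s \<le> t \<Longrightarrow>
      emeasure \<mu> (tube N Z E {s<..<t}) = emeasure (\<mu>\<^sub>N \<phi>) E * ennreal (t - s)"
proof -
  obtain w where w: "\<And>t. lie_exp (semidirect N) (t *\<^sub>R Z) = (flow_curve w t, exp t)"
    using lie_exp_flow_curve[OF Z] by blast
  show "open E \<Longrightarrow> open I \<Longrightarrow> open (tube N Z E I)"
    by (rule open_tube_of_flow_curve[OF w])
  show "tube N Z E I \<subseteq> carrier (semidirect N)"
    by (auto simp: carrier_semidirect mem_tube_iff[OF w])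
  show "tube N Z E I \<inter> tube N Z E' I' \<noteq> {} \<Longrightarrow> E \<inter> E' \<noteq> {} \<and> I \<inter> I' \<noteq> {}"
    using tube_meet_of_flow_curve[OF w] by blast
  show "flow_measure N Z \<phi> \<mu> \<Longrightarrow> open E \<Longrightarrow> s \<le> t \<Longrightarrow>
      emeasure \<mu> (tube N Z E {s<..<t}) = emeasure (\<mu>\<^sub>N \<phi>) E * ennreal (t - s)"
    by (rule emeasure_tube_of_flow_curve[OF w])
qed

end

lemma tube_mono: "E \<subseteq> E' \<Longrightarrow> I \<subseteq> I' \<Longrightarrow> tube N Z E I \<subseteq> tube N Z E' I'"
  unfolding tube_def by blast

section \<open>Nesting and comparison of admissible cylinders\<close>

text \<open>If \<open>Q\<close> meets a cube, it meets the parent of that cube. Climbing from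
  generation \<open>k'\<close> to \<open>k\<close> ends in a cube of the generation of
  \<open>Q\<close>, and two such cubes that meet coincide.\<close>

lemma (in christ_cubes) cube_nested:
  assumes "Q \<in> \<Q> k" "Q' \<in> \<Q> k'" "k \<le> k'" "Q \<inter> Q' \<noteq> {}"
  shows "Q' \<subseteq> Q"
proof -
  have "R \<in> \<Q> (k + int d) \<Longrightarrow> Q \<inter> R \<noteq> {} \<Longrightarrow> R \<subseteq> Q" for d R
  proof (induction d arbitrary: R)
    case 0
    then show ?case using disjoint_cubes[of k] assms(1) disjointD by fastforce
  next
    case (Suc d)
    obtain p where "p \<in> \<Q> (k + int (Suc d) - 1)" "R \<subseteq> p"
      using unique_parent[OF Suc.prems(1)] by blast
    then show ?case using Suc.IH[of p] Suc.prems(2) by (auto simp: algebra_simps)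
  qed
  from this[of Q' "nat (k' - k)"] assms show ?thesis by simp
qed

text \<open>A member of least rank is kept, all members that meet it are discarded, and the rest is
  treated recursively. Nonemptiness of \<open>S\<close> lets a kept set count as meeting
  itself.\<close>

lemma greedy_disjoint_subfamily:
  fixes rank :: "'b set \<Rightarrow> int"
  assumes "finite \<F>"
  shows "\<exists>\<T>\<subseteq>\<F>. disjoint \<T> \<and> (\<forall>S\<in>\<F>. S \<noteq> {} \<longrightarrow> (\<exists>T\<in>\<T>. S \<inter> T \<noteq> {} \<and> rank T \<le> rank S))"
  using assms
proof (induction \<F> rule: finite_psubset_induct)
  case (psubset \<F>)
  show ?case
  proof (cases "\<F> = {}")
    case False
    define M where "M = arg_min_on rank \<F>"
    have M: "M \<in> \<F>" "\<And>S. S \<in> \<F> \<Longrightarrow> rank M \<le> rank S"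
      unfolding M_def
      by (rule arg_min_if_finite(1)[OF psubset.hyps(1) False])
        (rule arg_min_least[OF psubset.hyps(1) False])
    define \<G> where "\<G> = {S \<in> \<F>. S \<noteq> M \<and> S \<inter> M = {}}"
    have "\<G> \<subset> \<F>" using M(1) by (auto simp: \<G>_def)
    then obtain \<T> where \<T>: "\<T> \<subseteq> \<G>" "disjoint \<T>"
      "\<forall>S\<in>\<G>. S \<noteq> {} \<longrightarrow> (\<exists>T\<in>\<T>. S \<inter> T \<noteq> {} \<and> rank T \<le> rank S)"
      using psubset.IH[OF \<open>\<G> \<subset> \<F>\<close>] by blast
    have "insert M \<T> \<subseteq> \<F>" using M(1) \<T>(1) by (auto simp: \<G>_def)
    moreover have "disjoint (insert M \<T>)"
      using \<T>(1,2) by (auto simp: disjoint_def \<G>_def)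
    moreover have "\<exists>T\<in>insert M \<T>. S \<inter> T \<noteq> {} \<and> rank T \<le> rank S" if "S \<in> \<F>" "S \<noteq> {}" for S
    proof (cases "S \<in> \<G>")
      case True
      then show ?thesis using \<T>(3) that by blast
    next
      case False
      then have "S \<inter> M \<noteq> {}" using that by (auto simp: \<G>_def)
      then show ?thesis using M(2) that by blast
    qed
    ultimately show ?thesis by blast
  qed auto
qed

section \<open>Admissibility on the logarithmic scale and comparison of heights\<close>

abbreviation admissible_params :: "real \<Rightarrow> real \<Rightarrow> real \<Rightarrow> int \<Rightarrow> real \<Rightarrow> real \<Rightarrow> bool" where
  "admissible_params \<delta> \<gamma> lam k r a \<equiv> large_params \<delta> \<gamma> lam k r a \<or> small_params \<delta> lam k r a"

text \<open>The constant \<open>C\<^sub>2 / 3\<close> of the weak type inequality.\<close>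

definition height_ratio :: "real \<Rightarrow> real \<Rightarrow> real" where
  "height_ratio \<gamma> lam = max (\<gamma> + 1 + ln lam) (lam * exp 3)"

text \<open>On the logarithmic scale \<open>ln a\<close> is the midpoint of the time interval and
  \<open>ln r\<close> its half-length, and the conditions become linear in both.\<close>

lemma large_params_ln:
  assumes "large_params \<delta> \<gamma> lam k r a" "0 < a" "0 < lam" "0 < \<delta>"
  shows "1 < ln r" "ln a + 2 * ln r \<le> ln (\<delta> powi k)" "ln (\<delta> powi k) \<le> ln lam + ln a + \<gamma> * ln r"
proof -
  have r: "exp 1 < r" "0 < r" and le: "a * r\<^sup>2 \<le> \<delta> powi k" "\<delta> powi k \<le> lam * a * r powr \<gamma>"
    using assms(1) less_trans[OF exp_gt_zero] by (auto simp: large_params_def)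
  show "1 < ln r" using r by (metis exp_less_cancel_iff exp_ln)
  have "ln (a * r\<^sup>2) \<le> ln (\<delta> powi k)"
    using le(1) r assms by (subst ln_le_cancel_iff) auto
  then show "ln a + 2 * ln r \<le> ln (\<delta> powi k)"
    using r assms by (simp add: ln_mult ln_realpow)
  have "ln (\<delta> powi k) \<le> ln (lam * a * r powr \<gamma>)"
    using le(2) r assms by (subst ln_le_cancel_iff) auto
  then show "ln (\<delta> powi k) \<le> ln lam + ln a + \<gamma> * ln r"
    using r assms by (simp add: ln_mult ln_powr)
qed

lemma small_params_ln:
  assumes "small_params \<delta> lam k r a" "0 < a" "0 < lam" "0 < \<delta>"
  shows "0 < ln r" "ln r \<le> 1" "ln a + 2 + ln (ln r) \<le> ln (\<delta> powi k)"
    "ln (\<delta> powi k) \<le> ln lam + ln a + 2 + ln (ln r)"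
proof -
  have r: "1 < r" "r \<le> exp 1" and le: "a * exp 2 * ln r \<le> \<delta> powi k" "\<delta> powi k \<le> lam * a * exp 2 * ln r"
    using assms(1) by (auto simp: small_params_def)
  show l: "0 < ln r" using r by simp
  show "ln r \<le> 1" using r by (metis exp_le_cancel_iff exp_ln less_trans zero_less_one)
  have "ln (a * exp 2 * ln r) \<le> ln (\<delta> powi k)"
    using le(1) l assms by (subst ln_le_cancel_iff) auto
  then show "ln a + 2 + ln (ln r) \<le> ln (\<delta> powi k)"
    using l assms by (simp add: ln_mult)
  have "ln (\<delta> powi k) \<le> ln (lam * a * exp 2 * ln r)"
    using le(2) l assms by (subst ln_le_cancel_iff) auto
  then show "ln (\<delta> powi k) \<le> ln lam + ln a + 2 + ln (ln r)"
    using l assms by (simp add: ln_mult)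
qed

lemma height_ratio_ge:
  assumes "1 \<le> lam" "0 \<le> \<gamma>"
  shows "1 \<le> height_ratio \<gamma> lam"
proof -
  have "1 \<le> \<gamma> + 1 + ln lam" using assms by simp
  then show ?thesis unfolding height_ratio_def by linarith
qed

text \<open>The unprimed cylinder lies over the coarser cube. The lower bound on
  \<open>\<delta> powi k'\<close> and the upper bound on \<open>\<delta> powi k\<close> are linked
  by \<open>k \<le> k'\<close>, while \<open>meet\<close> bounds \<open>ln a - ln a'\<close> by
  \<open>ln r + ln r'\<close>. This settles all combinations of large and small except a small
  primed cylinder against a large one, where \<open>ln r' \<le> 1 < ln r\<close>.\<close>

lemma admissible_height_le:
  assumes adm: "admissible_params \<delta> \<gamma> lam k r a" "0 < a"
    and adm': "admissible_params \<delta> \<gamma> lam k' r' a'" "0 < a'"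
    and \<delta>: "0 < \<delta>" "\<delta> < 1" and k: "k \<le> k'" and lam: "1 \<le> lam" and \<gamma>: "0 \<le> \<gamma>"
    and meet: "ln a - ln r < ln a' + ln r'"
  shows "ln r' \<le> height_ratio \<gamma> lam * ln r"
proof -
  have "\<delta> powi k' \<le> \<delta> powi k"
    using \<delta> k by (intro power_int_decreasing) auto
  then have D: "ln (\<delta> powi k') \<le> ln (\<delta> powi k)"
    using \<delta> by (subst ln_le_cancel_iff) auto
  have lam0: "0 < lam" and lnlam: "0 \<le> ln lam" using lam by auto
  have e: "2 \<le> exp (1::real)" using exp_ge_add_one_self[of 1] by simp
  note large = large_params_ln[OF _ _ lam0 \<delta>(1)] and small = small_params_ln[OF _ _ lam0 \<delta>(1)]
  show ?thesis
  proof (cases "large_params \<delta> \<gamma> lam k r a")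
    case True
    note L = large[OF True adm(2)]
    have "ln r' \<le> (\<gamma> + 1 + ln lam) * ln r"
    proof (cases "large_params \<delta> \<gamma> lam k' r' a'")
      case True
      \<comment> \<open>The square in \<open>a' * r'\<^sup>2\<close> provides
        \<open>2 * ln r'\<close>, half of which absorbs the \<open>ln r'\<close> from
        \<open>meet\<close>. Afterwards \<open>1 < ln r\<close> allows \<open>ln lam\<close> to be
        multiplied by \<open>ln r\<close>.\<close>
      have "ln r' \<le> ln lam * 1 + (\<gamma> + 1) * ln r"
        using large(2)[OF True adm'(2)] D L(3) meet by (simp add: algebra_simps)
      also have "\<dots> \<le> ln lam * ln r + (\<gamma> + 1) * ln r"
        using L(1) lnlam by (intro add_right_mono mult_left_mono) auto
      finally show ?thesis by (simp add: algebra_simps)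
    next
      case False
      then have "ln r' \<le> 1" using adm' small(2) by blast
      also have "1 \<le> ln r" using L(1) by simp
      also have "ln r \<le> (\<gamma> + 1 + ln lam) * ln r"
        using mult_right_mono[of 1 "\<gamma> + 1 + ln lam" "ln r"] L(1) lnlam \<gamma> by simp
      finally show ?thesis .
    qed
    also have "\<dots> \<le> height_ratio \<gamma> lam * ln r"
      using L(1) by (intro mult_right_mono) (auto simp: height_ratio_def)
    finally show ?thesis .
  next
    case False
    then have sm: "small_params \<delta> lam k r a" using adm(1) by blast
    note S = small[OF sm adm(2)]
    have e3: "lam * exp 3 = lam * exp 2 * exp 1"
      by (simp add: mult_exp_exp)
    have p: "1 \<le> lam * exp 2"
      using lam mult_mono[of 1 lam 1 "exp 2"] by simp
    have "ln r' \<le> lam * exp 3 * ln r"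
    proof (cases "large_params \<delta> \<gamma> lam k' r' a'")
      case True
      have "ln (lam * exp 2 * ln r) = ln lam + 2 + ln (ln r)"
        using lam0 S(1) by (simp add: ln_mult)
      \<comment> \<open>\<open>ln x \<le> x\<close> makes the bound proportional to
        \<open>ln r\<close>, however small that is. The second summand \<open>ln r\<close> is then
        paid for by \<open>2 \<le> exp 1\<close>, whence the third power of
        \<open>exp 1\<close>.\<close>
      moreover have "ln (lam * exp 2 * ln r) \<le> lam * exp 2 * ln r"
        using ln_le_minus_one[of "lam * exp 2 * ln r"] lam0 S(1) by (simp add: zero_less_mult_iff)
      ultimately have "ln r' \<le> 1 * ln r + lam * exp 2 * ln r"
        using large(2)[OF True adm'(2)] D S(4) meet by simp
      also have "\<dots> \<le> lam * exp 2 * ln r + lam * exp 2 * ln r"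
        using p S(1) by (intro add_right_mono mult_right_mono) auto
      also have "\<dots> = lam * exp 2 * ln r * 2" by simp
      also have "\<dots> \<le> lam * exp 2 * ln r * exp 1"
        using e lam0 S(1) by (intro mult_left_mono) auto
      also have "\<dots> = lam * exp 3 * ln r" by (simp add: e3)
      finally show ?thesis .
    next
      case False
      then have "small_params \<delta> lam k' r' a'" using adm'(1) by blast
      note S' = small[OF this adm'(2)]
      \<comment> \<open>Both half-lengths are at most 1, so \<open>ln a - ln a'\<close> is less than
        2; this 2 becomes the factor \<open>exp 2\<close>.\<close>
      have "ln (ln r') \<le> ln (ln r) + ln lam + 2"
        using S'(2,3) S(2,4) D meet by linarith
      also have "\<dots> = ln (lam * exp 2 * ln r)"
        using lam0 S(1) by (simp add: ln_mult)
      finally have "ln r' \<le> lam * exp 2 * ln r * 1"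
        using lam0 S(1) S'(1) by (subst (asm) ln_le_cancel_iff) auto
      also have "\<dots> \<le> lam * exp 2 * ln r * exp 1"
        using lam0 S(1) by (intro mult_left_mono) auto
      also have "\<dots> = lam * exp 3 * ln r" by (simp add: e3)
      finally show ?thesis .
    qed
    also have "\<dots> \<le> height_ratio \<gamma> lam * ln r"
      using S(1) by (intro mult_right_mono) (auto simp: height_ratio_def)
    finally show ?thesis .
  qed
qed

lemma admissible_params_gt_1: "admissible_params \<delta> \<gamma> lam k r a \<Longrightarrow> 1 < r"
  using less_trans[of 1 "exp 1" r] by (auto simp: large_params_def small_params_def)

section \<open>The weak type inequality\<close>

lemma sum_nn_integral_disjoint_le:
  assumes "finite \<T>" "disjoint \<T>" "\<T> \<subseteq> sets M" "g \<in> borel_measurable M"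
  shows "(\<Sum>T\<in>\<T>. \<integral>\<^sup>+x\<in>T. g x \<partial>M) \<le> integral\<^sup>N M g"
proof -
  have "(\<Sum>T\<in>\<T>. \<integral>\<^sup>+x\<in>T. g x \<partial>M) = (\<integral>\<^sup>+x. (\<Sum>T\<in>\<T>. g x * indicator T x) \<partial>M)"
    using assms by (intro nn_integral_sum[symmetric] borel_measurable_times_ennreal) auto
  also have "\<dots> \<le> integral\<^sup>N M g"
  proof (rule nn_integral_mono)
    fix x
    have "disjoint_family_on (\<lambda>T. T) \<T>"
      using assms(2) by (auto simp: disjoint_def disjoint_family_on_def)
    from indicator_UN_disjoint[OF assms(1) this, of x]
    have "(indicator (\<Union>\<T>) x :: ennreal) = (\<Sum>T\<in>\<T>. indicator T x)"
      by simp
    then have "(\<Sum>T\<in>\<T>. g x * indicator T x) = g x * indicator (\<Union>\<T>) x"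
      by (simp flip: sum_distrib_left)
    then show "(\<Sum>T\<in>\<T>. g x * indicator T x) \<le> g x"
      by (simp add: indicator_def)
  qed
  finally show ?thesis .
qed

lemma sets_flow_measure: "flow_measure N Z \<phi> \<mu> \<Longrightarrow> sets \<mu> = sets right_haar"
  by (simp add: flow_measure_def)

lemma (in stratified_group) admissible_cylinderE:
  assumes cubes: "christ_cubes N m \<Q> \<delta> C1 c" and P: "P \<in> admissible_cylinders N Z \<Q> \<delta> \<gamma> lam"
  obtains Q k r a where "P = tube N Z Q {ln a - ln r<..<ln a + ln r}" "0 < a" "1 < r" "Q \<in> \<Q> k"
    "open Q" "admissible_params \<delta> \<gamma> lam k r a"
proof -
  obtain r Q a k where P: "P = cylinder N Z r Q a" "0 < a" "Q \<in> \<Q> k" "admissible_params \<delta> \<gamma> lam k r a"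
    using P unfolding admissible_cylinders_def by blast
  have r: "1 < r" using admissible_params_gt_1[OF P(4)] .
  have "ln (a / r) = ln a - ln r" "ln (a * r) = ln a + ln r"
    using r P(2) by (simp_all add: ln_div ln_mult)
  then show ?thesis
    using that[of Q a r k] P r christ_cubes.open_cubes[OF cubes P(3)] by (simp add: cylinder_eq_tube)
qed

text \<open>Each cylinder lies in the dilate of a selected one of coarser or equal generation, so
  only the averages over the disjoint selected cylinders have to be added up.\<close>

lemma (in stratified_group) emeasure_finite_Union_cylinders_le:
  assumes Z: "Z \<in> \<Z> N" and \<phi>: "flow_measure N Z \<phi> \<mu>"
    and cubes: "christ_cubes N m \<Q> \<delta> C1 c" and \<gamma>: "0 \<le> \<gamma>" and lam: "1 \<le> lam"
    and g: "g \<in> borel_measurable \<mu>"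
    and \<F>: "finite \<F>" "\<F> \<subseteq> admissible_cylinders N Z \<Q> \<delta> \<gamma> lam"
    and avg: "\<And>P. P \<in> \<F> \<Longrightarrow> \<alpha> * emeasure \<mu> P \<le> (\<integral>\<^sup>+y\<in>P. g y \<partial>\<mu>)"
  shows "\<alpha> * emeasure \<mu> (\<Union>\<F>) \<le> ennreal (3 * height_ratio \<gamma> lam) * integral\<^sup>N \<mu> g"
proof -
  interpret christ_cubes N m \<Q> \<delta> C1 c by fact
  define \<kappa> where "\<kappa> = height_ratio \<gamma> lam"
  have \<kappa>: "1 \<le> \<kappa>" unfolding \<kappa>_def by (rule height_ratio_ge[OF lam \<gamma>])
  define params where "params = (\<lambda>P Q k r a. P = tube N Z Q {ln a - ln r<..<ln a + ln r} \<and>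
      0 < a \<and> 1 < r \<and> Q \<in> \<Q> k \<and> open Q \<and> admissible_params \<delta> \<gamma> lam k r a)"
  have "\<exists>Q k r a. params P Q k r a" if PF: "P \<in> \<F>" for P
  proof -
    have "P \<in> admissible_cylinders N Z \<Q> \<delta> \<gamma> lam" using PF \<F>(2) by blast
    from admissible_cylinderE[OF cubes this] show ?thesis
      unfolding params_def by (metis (no_types))
  qed
  then obtain Q k r a where "\<And>P. P \<in> \<F> \<Longrightarrow> params P (Q P) (k P) (r P) (a P)"
    by metis
  then have P: "P = tube N Z (Q P) {ln (a P) - ln (r P)<..<ln (a P) + ln (r P)}"
    "0 < a P" "1 < r P" "Q P \<in> \<Q> (k P)" "open (Q P)" "admissible_params \<delta> \<gamma> lam (k P) (r P) (a P)"
    if "P \<in> \<F>" for P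
    using that unfolding params_def by blast+
  \<comment> \<open>An interval of half-length at most \<open>\<kappa> * ln (r P)\<close> that meets
    the one of \<open>P\<close> reaches at most \<open>2 * \<kappa> * ln (r P)\<close> beyond
    it.\<close>
  define dilate where "dilate = (\<lambda>P. tube N Z (Q P)
      {ln (a P) - (1 + 2 * \<kappa>) * ln (r P)<..<ln (a P) + (1 + 2 * \<kappa>) * ln (r P)})"
  have sets: "tube N Z E {s<..<t} \<in> sets \<mu>" if "open E" for E s t
    unfolding sets_flow_measure[OF \<phi>] using that tube_subset_carrier[OF Z]
    by (intro open_in_sets_right_haar open_tube[OF Z]) (auto simp: carrier_semidirect)
  have P_sets: "P \<in> sets \<mu>" "dilate P \<in> sets \<mu>" if PF: "P \<in> \<F>" for P
    by (subst P(1)[OF PF]) (auto simp: dilate_def intro: sets P(5)[OF PF])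
  have dilate_le: "emeasure \<mu> (dilate P) \<le> ennreal (3 * \<kappa>) * emeasure \<mu> P" if PF: "P \<in> \<F>" for P
  proof -
    have l: "0 < ln (r P)" using P(3)[OF PF] by simp
    have "emeasure \<mu> (dilate P) = emeasure (\<mu>\<^sub>N \<phi>) (Q P) * ennreal ((1 + 2 * \<kappa>) * (2 * ln (r P)))"
      unfolding dilate_def using l \<kappa> by (subst emeasure_tube[OF Z \<phi> P(5)[OF PF]]) (auto simp: algebra_simps)
    \<comment> \<open>\<open>1 + 2 * \<kappa> \<le> 3 * \<kappa>\<close> because
      \<open>\<kappa>\<close> is at least 1.\<close>
    also have "\<dots> \<le> emeasure (\<mu>\<^sub>N \<phi>) (Q P) * ennreal (3 * \<kappa> * (2 * ln (r P)))"
      using l \<kappa> by (intro mult_left_mono ennreal_leI mult_right_mono) auto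
    also have "\<dots> = ennreal (3 * \<kappa>) * (emeasure (\<mu>\<^sub>N \<phi>) (Q P) * ennreal (2 * ln (r P)))"
      using l \<kappa> by (subst ennreal_mult) (auto simp: mult_ac)
    also have "emeasure (\<mu>\<^sub>N \<phi>) (Q P) * ennreal (2 * ln (r P)) = emeasure \<mu> P"
      using emeasure_tube[OF Z \<phi> P(5)[OF PF], of "ln (a P) - ln (r P)" "ln (a P) + ln (r P)"] l
      by (simp flip: P(1)[OF PF])
    finally show ?thesis .
  qed
  obtain \<T> where \<T>: "\<T> \<subseteq> \<F>" "disjoint \<T>"
    "\<forall>S\<in>\<F>. S \<noteq> {} \<longrightarrow> (\<exists>T\<in>\<T>. S \<inter> T \<noteq> {} \<and> k T \<le> k S)"
    using greedy_disjoint_subfamily[OF \<F>(1), of k] by blast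
  have fin: "finite \<T>" using \<T>(1) \<F>(1) finite_subset by blast
  have "\<Union>\<F> \<subseteq> (\<Union>T\<in>\<T>. dilate T)"
  proof
    fix x assume "x \<in> \<Union>\<F>"
    then obtain S where S: "S \<in> \<F>" "x \<in> S" by blast
    then obtain T where T: "T \<in> \<T>" "T \<inter> S \<noteq> {}" "k T \<le> k S" using \<T>(3) by blast
    then have TF: "T \<in> \<F>" using \<T>(1) by blast
    let ?I = "\<lambda>P. {ln (a P) - ln (r P)<..<ln (a P) + ln (r P)}"
    have "Q T \<inter> Q S \<noteq> {} \<and> ?I T \<inter> ?I S \<noteq> {}"
      using T(2) P(1)[OF S(1)] P(1)[OF TF] tube_meet[OF Z, of "Q T" "?I T" "Q S" "?I S"] by simp
    then have meet: "Q T \<inter> Q S \<noteq> {}" "ln (a T) - ln (r T) < ln (a S) + ln (r S)"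
      "ln (a S) - ln (r S) < ln (a T) + ln (r T)" by auto
    have "Q S \<subseteq> Q T"
      by (rule cube_nested[OF P(4)[OF TF] P(4)[OF S(1)] T(3) meet(1)])
    moreover have "ln (r S) \<le> \<kappa> * ln (r T)"
      unfolding \<kappa>_def
      by (rule admissible_height_le[OF P(6)[OF TF] P(2)[OF TF] P(6)[OF S(1)] P(2)[OF S(1)]
            delta T(3) lam \<gamma> meet(2)])
    then have "?I S \<subseteq> {ln (a T) - (1 + 2 * \<kappa>) * ln (r T)<..<ln (a T) + (1 + 2 * \<kappa>) * ln (r T)}"
      using meet by (auto simp: algebra_simps)
    ultimately have "S \<subseteq> dilate T"
      unfolding dilate_def by (subst P(1)[OF S(1)]) (rule tube_mono)
    then show "x \<in> (\<Union>T\<in>\<T>. dilate T)" using T(1) S(2) by blast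
  qed
  then have "emeasure \<mu> (\<Union>\<F>) \<le> emeasure \<mu> (\<Union>T\<in>\<T>. dilate T)"
    using P_sets \<T>(1) fin by (intro emeasure_mono sets.finite_UN) auto
  also have "\<dots> \<le> (\<Sum>T\<in>\<T>. emeasure \<mu> (dilate T))"
    using P_sets \<T>(1) fin by (intro emeasure_subadditive_finite) auto
  also have "\<dots> \<le> (\<Sum>T\<in>\<T>. ennreal (3 * \<kappa>) * emeasure \<mu> T)"
    using \<T>(1) dilate_le by (intro sum_mono) auto
  finally have "\<alpha> * emeasure \<mu> (\<Union>\<F>) \<le> \<alpha> * (\<Sum>T\<in>\<T>. ennreal (3 * \<kappa>) * emeasure \<mu> T)"
    by (intro mult_left_mono) auto
  also have "\<dots> = ennreal (3 * \<kappa>) * (\<Sum>T\<in>\<T>. \<alpha> * emeasure \<mu> T)"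
    by (simp add: sum_distrib_left mult_ac)
  also have "\<dots> \<le> ennreal (3 * \<kappa>) * (\<Sum>T\<in>\<T>. \<integral>\<^sup>+y\<in>T. g y \<partial>\<mu>)"
    using avg \<T>(1) by (intro mult_left_mono sum_mono) auto
  also have "\<dots> \<le> ennreal (3 * \<kappa>) * integral\<^sup>N \<mu> g"
    using fin \<T>(1,2) P_sets(1) g by (intro mult_left_mono sum_nn_integral_disjoint_le) auto
  finally show ?thesis by (simp add: \<kappa>_def)
qed

section \<open>From finite families of cylinders to the superlevel set\<close>

lemma emeasure_countable_Union_le:
  assumes "countable \<F>" "\<F> \<subseteq> sets M"
    and "\<And>\<G>. finite \<G> \<Longrightarrow> \<G> \<subseteq> \<F> \<Longrightarrow> emeasure M (\<Union>\<G>) \<le> B"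
  shows "emeasure M (\<Union>\<F>) \<le> B"
proof (cases "\<F> = {}")
  case False
  define A where "A = (\<lambda>n::nat. \<Union>(from_nat_into \<F> ` {..n}))"
  have \<F>: "from_nat_into \<F> n \<in> \<F>" for n using from_nat_into[OF False] .
  have "\<Union>\<F> = (\<Union>n. A n)"
  proof
    show "\<Union>\<F> \<subseteq> (\<Union>n. A n)"
    proof
      fix x assume "x \<in> \<Union>\<F>"
      then obtain n where "x \<in> from_nat_into \<F> n"
        using range_from_nat_into[OF False assms(1)] by (metis UnionE rangeE)
      then show "x \<in> (\<Union>n. A n)" unfolding A_def by auto
    qed
    show "(\<Union>n. A n) \<subseteq> \<Union>\<F>" unfolding A_def using \<F> by blast
  qed
  moreover have "(SUP n. emeasure M (A n)) = emeasure M (\<Union>n. A n)"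
  proof (rule SUP_emeasure_incseq)
    show "range A \<subseteq> sets M" unfolding A_def using \<F> assms(2) by blast
    show "incseq A" unfolding A_def by (intro monoI Union_mono image_mono) simp
  qed
  moreover have "emeasure M (A n) \<le> B" for n
    unfolding A_def using \<F> by (intro assms(3)) auto
  ultimately show ?thesis by (metis SUP_least)
qed simp

lemma ennreal_times_le_if_less_divide:
  fixes x y :: ennreal
  assumes "ennreal \<alpha> < x / y"
  shows "ennreal \<alpha> * y \<le> x"
proof (cases "y = 0 \<or> y = \<infinity>")
  \<comment> \<open>For \<open>y = 0\<close> the left side is 0; \<open>y = \<infinity>\<close> is
    excluded, since a quotient by infinity is 0 in \<open>ennreal\<close>.\<close>
  case True
  then show ?thesis using assms by auto
next
  case False
  then have "ennreal \<alpha> * y \<le> x / y * y"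
    using assms by (intro mult_right_mono) auto
  also have "x / y * y = x"
    using False by (simp add: ennreal_divide_times ennreal_divide_self less_top)
  finally show ?thesis .
qed

theorem theorem4p2:
  fixes N :: "'a::euclidean_space stratified"
    and Z :: "'a \<times> real"
    and \<phi> :: "'a \<times> real \<Rightarrow> real"
    and \<mu> :: "('a \<times> real) measure"
    and \<Q> :: "int \<Rightarrow> 'a set set"
    and \<delta> C1 c \<gamma> lam \<alpha> :: real
    and f :: "'a \<times> real \<Rightarrow> 'b::{banach, second_countable_topology}"
  assumes "stratified_group N"
    and "Z \<in> \<Z> N"
    and "doubling_flow_measure N Z \<phi> \<mu>"
    and "christ_cubes N (\<mu>\<^sub>N \<phi>) \<Q> \<delta> C1 c"
    and "5 \<le> \<gamma>"
    and "exp 3 / \<delta> < lam"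
    and "0 < \<alpha>"
    and "integrable \<mu> f"
  shows "{x \<in> carrier (semidirect N).
            ennreal \<alpha> < maximal_op \<mu> (admissible_cylinders N Z \<Q> \<delta> \<gamma> lam) f x} \<in> sets \<mu>
    \<and> emeasure \<mu> {x \<in> carrier (semidirect N).
            ennreal \<alpha> < maximal_op \<mu> (admissible_cylinders N Z \<Q> \<delta> \<gamma> lam) f x}
          \<le> ennreal (3 * max (\<gamma> + 1 + ln lam) (lam * exp 3) / \<alpha> * (\<integral>x. norm (f x) \<partial>\<mu>))"
proof -
  interpret stratified_group N by fact
  let ?\<P> = "admissible_cylinders N Z \<Q> \<delta> \<gamma> lam"
  let ?g = "\<lambda>x. ennreal (norm (f x))"
  define \<Omega> where "\<Omega> = {x \<in> carrier (semidirect N). ennreal \<alpha> < maximal_op \<mu> ?\<P> f x}"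
  define bad where "bad = {P \<in> ?\<P>. ennreal \<alpha> < (\<integral>\<^sup>+y\<in>P. ?g y \<partial>\<mu>) / emeasure \<mu> P}"
  have \<phi>: "flow_measure N Z \<phi> \<mu>"
    using assms(3) by (simp add: doubling_flow_measure_def)
  \<comment> \<open>As \<open>\<delta> < 1\<close>, the lower bound imposed on \<open>lam\<close> is
    at least 1, which makes \<open>ln lam\<close> nonnegative.\<close>
  have "1 \<le> exp 3 / \<delta>"
    using christ_cubes.delta[OF assms(4)] one_le_exp_iff[of "3::real"]
    by (simp add: pos_le_divide_eq del: one_le_exp_iff)
  then have lam: "1 \<le> lam" using assms(6) by simp
  have g: "?g \<in> borel_measurable \<mu>"
    using assms(8) by (intro measurable_compose[OF _ measurable_ennreal]) auto
  have cyl: "open P" "P \<subseteq> carrier (semidirect N)" if P: "P \<in> ?\<P>" for P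
  proof -
    obtain Q k r a where "P = tube N Z Q {ln a - ln r<..<ln a + ln r}" "open Q"
      using admissible_cylinderE[OF assms(4) P] by metis
    then show "open P" "P \<subseteq> carrier (semidirect N)"
      using open_tube[OF assms(2)] tube_subset_carrier[OF assms(2)] by auto
  qed
  \<comment> \<open>A supremum exceeds \<open>\<alpha>\<close> exactly if one of its members does.
    The superlevel set is thus a union of open cylinders.\<close>
  have \<Omega>: "\<Omega> = \<Union>bad"
    using cyl(2) by (auto simp: \<Omega>_def bad_def maximal_op_def less_SUP_iff)
  have sets: "P \<in> sets \<mu>" if "open P" "P \<subseteq> carrier (semidirect N)" for P
    using open_in_sets_right_haar[OF that(1)] that(2)
    by (simp add: sets_flow_measure[OF \<phi>] carrier_semidirect)
  have "open \<Omega>" "\<Omega> \<subseteq> carrier (semidirect N)"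
    unfolding \<Omega> using cyl by (auto simp: bad_def)
  then have \<Omega>_sets: "\<Omega> \<in> sets \<mu>" by (rule sets)
  let ?C = "3 * height_ratio \<gamma> lam"
  have "1 \<le> height_ratio \<gamma> lam" using height_ratio_ge[OF lam] assms(5) by simp
  then have C: "0 \<le> ?C" by simp
  \<comment> \<open>\<open>a\<close> and \<open>r\<close> range over reals, so \<open>bad\<close>
    may be uncountable; a countable subfamily with the same union makes continuity from below
    applicable.\<close>
  obtain \<F> where \<F>: "\<F> \<subseteq> bad" "countable \<F>" "\<Union>\<F> = \<Union>bad"
    using Lindelof[of bad] cyl(1) by (auto simp: bad_def)
  have "emeasure \<mu> (\<Union>\<F>) \<le> ennreal (?C / \<alpha> * (\<integral>x. norm (f x) \<partial>\<mu>))"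
  proof (rule emeasure_countable_Union_le[OF \<F>(2)])
    show "\<F> \<subseteq> sets \<mu>" using \<F>(1) cyl sets by (auto simp: bad_def)
    fix \<G> assume \<G>: "finite \<G>" "\<G> \<subseteq> \<F>"
    have "ennreal \<alpha> * emeasure \<mu> (\<Union>\<G>) \<le> ennreal ?C * (\<integral>\<^sup>+x. ?g x \<partial>\<mu>)"
    proof (rule emeasure_finite_Union_cylinders_le[OF assms(2) \<phi> assms(4) _ lam g \<G>(1)])
      show "\<G> \<subseteq> ?\<P>" "0 \<le> \<gamma>" using \<G>(2) \<F>(1) assms(5) by (auto simp: bad_def)
      show "ennreal \<alpha> * emeasure \<mu> P \<le> (\<integral>\<^sup>+y\<in>P. ?g y \<partial>\<mu>)" if "P \<in> \<G>" for P
        using that \<G>(2) \<F>(1) by (intro ennreal_times_le_if_less_divide) (auto simp: bad_def)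
    qed
    also have "(\<integral>\<^sup>+x. ?g x \<partial>\<mu>) = ennreal (\<integral>x. norm (f x) \<partial>\<mu>)"
      using assms(8) by (intro nn_integral_eq_integral) auto
    finally have "ennreal (1 / \<alpha>) * (ennreal \<alpha> * emeasure \<mu> (\<Union>\<G>))
        \<le> ennreal (1 / \<alpha>) * (ennreal ?C * ennreal (\<integral>x. norm (f x) \<partial>\<mu>))"
      by (intro mult_left_mono) auto
    also have "ennreal (1 / \<alpha>) * (ennreal \<alpha> * emeasure \<mu> (\<Union>\<G>)) = emeasure \<mu> (\<Union>\<G>)"
      using assms(7) by (simp flip: mult.assoc ennreal_mult)
    also have "ennreal (1 / \<alpha>) * (ennreal ?C * ennreal (\<integral>x. norm (f x) \<partial>\<mu>))
        = ennreal (?C / \<alpha> * (\<integral>x. norm (f x) \<partial>\<mu>))"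
      using assms(7) C by (simp flip: ennreal_mult add: field_simps)
    finally show "emeasure \<mu> (\<Union>\<G>) \<le> ennreal (?C / \<alpha> * (\<integral>x. norm (f x) \<partial>\<mu>))" .
  qed
  then show ?thesis
    using \<Omega>_sets by (simp only: \<F>(3) height_ratio_def flip: \<Omega> \<Omega>_def)
qed

end
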